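(* Let $E$ be a full heap over a Dynkin diagram $\Gamma$ with vertex set $P$ and generalized Cartan matrix $A=(a_{ij})$, let $k$ be a field of characteristic different from $2$, and let $V_E$ be the $k$-vector space with basis $\{v_I : I \text{ a proper ideal of } E\}$. Let $\mathfrak g$ be the Lie algebra over $k$ with generators $\{e_i,f_i,h_i : i\in P\}$ and defining relations $$[h_i,h_j]=0,\quad [h_i,e_j]=a_{ij}e_j,\quad [h_i,f_j]=-a_{ij}f_j,\quad [e_i,f_j]=\delta_{ij}h_i,$$ $$(\operatorname{ad} e_i)^{1-a_{ij}}(e_j)=0,\quad (\operatorname{ad} f_i)^{1-a_{ij}}(f_j)=0\quad (i\neq j).$$ Then $V_E$ becomes a left $\mathfrak g$-module in which $e_i$, $f_i$, $h_i$ act as the operators $X_i$, $Y_i$, $H_i$ respectively.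
   Context: All generalized Cartan matrices have entries in $\{2,0,-1,-2\}$: $a_{ii}=2$, $a_{ij}\le 0$ for $i\ne j$, $a_{ij}=0\iff a_{ji}=0$. In the Dynkin diagram $\Gamma$, whose vertex set $P$ indexes the rows of $A$, distinct $p,q$ are adjacent iff $a_{pq}\neq0$ (with an arrow pointing towards $p$ if $a_{pq}=-2$). A labelled heap over $\Gamma$ is a triple $(E,\le,\varepsilon)$ with $(E,\le)$ a locally finite poset and $\varepsilon:E\to P$ such that (1) $\alpha,\beta\in E$ are comparable whenever $\varepsilon(\alpha),\varepsilon(\beta)$ are equal or adjacent; (2) $\le$ is the transitive closure of the relation "$\alpha\le\beta$ and $\varepsilon(\alpha),\varepsilon(\beta)$ are equal or adjacent". A heap is an isomorphism class of labelled heaps (isomorphisms are label-preserving poset isomorphisms); one works with a representative. $E$ is fibred if (a) for each $p\in P$ the chain $\varepsilon^{-1}(p)$ is unbounded above and below, and (b) for every pair $p,p'$ of adjacent vertices and $\alpha\in E$ with $\varepsilon(\alpha)=p$ there is $\beta\in E$ with $\varepsilon(\beta)=p'$ such that $\alpha$ covers $\beta$ or $\beta$ covers $\alpha$. $E$ is full if it is fibred and every open interval $(\alpha,\beta)$ with $\varepsilon(\alpha)=\varepsilon(\beta)=p$ and $(\alpha,\beta)\cap\varepsilon^{-1}(p)=\emptyset$ satisfies $\sum_{\gamma\in(\alpha,\beta)}a_{p,\varepsilon(\gamma)}=-2$. An ideal of $E$ is a downward closed subset. An ideal $I$ with $\emptyset\subsetneq I\subsetneq E$ is proper if $\emptyset\subsetneq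 I\cap\varepsilon^{-1}(p)\subsetneq\varepsilon^{-1}(p)$ for all $p\in P$. For a finite convex subset $L\subseteq E$ and a proper ideal $I$, write $L\succ I$ if $I\cup L$ is an ideal and $I\cap L=\emptyset$; write $L\prec I$ if $L\subseteq I$ and $I\setminus L$ is an ideal. Define linear operators on $V_E$: $X_L(v_I)=v_{I\cup L}$ if $L\succ I$, else $0$; $Y_L(v_I)=v_{I\setminus L}$ if $L\prec I$, else $0$; $H_L(v_I)=v_I$ if $L\prec I$ and $L\not\succ I$, $-v_I$ if $L\succ I$ and $L\not\prec I$, else $0$. For $p\in P$, $X_p=\sum_L X_L$, $Y_p=\sum_L Y_L$, $H_p=\sum_L H_L$, the sums being over all one-element subsets $L=\{\alpha\}$ with $\varepsilon(\alpha)=p$ (at most one term acts in a nonzero way on any given $v_I$). *)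

theory Defs
  imports "HOL-Library.Poly_Mapping" "HOL-Computational_Algebra.Computational_Algebra"
begin

section \<open>Generalized Cartan matrices and full heaps\<close>

text \<open>
  The vertex set \<open>P\<close> is the type \<^typ>\<open>'p\<close>, the underlying set of the heap is the type
  \<^typ>\<open>'e::order\<close>, and the heap order is the order of that type.
\<close>

definition generalized_cartan_matrix :: "('p \<Rightarrow> 'p \<Rightarrow> int) \<Rightarrow> bool" where
  "generalized_cartan_matrix A \<longleftrightarrow>
     (\<forall>p q. A p q \<in> {2, 0, -1, -2}) \<and>
     (\<forall>p. A p p = 2) \<and>
     (\<forall>p q. p \<noteq> q \<longrightarrow> A p q \<le> 0) \<and>
     (\<forall>p q. A p q = 0 \<longleftrightarrow> A q p = 0)"

definition dynkin_adjacent :: "('p \<Rightarrow> 'p \<Rightarrow> int) \<Rightarrow> 'p \<Rightarrow> 'p \<Rightarrow> bool" where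
  "dynkin_adjacent A p q \<longleftrightarrow> p \<noteq> q \<and> A p q \<noteq> 0"

definition labelled_heap :: "('p \<Rightarrow> 'p \<Rightarrow> int) \<Rightarrow> ('e::order \<Rightarrow> 'p) \<Rightarrow> bool" where
  "labelled_heap A \<epsilon> \<longleftrightarrow>
     (\<forall>\<alpha> \<beta> :: 'e. finite {\<alpha>..\<beta>}) \<and>
     (\<forall>\<alpha> \<beta>. \<epsilon> \<alpha> = \<epsilon> \<beta> \<or> dynkin_adjacent A (\<epsilon> \<alpha>) (\<epsilon> \<beta>) \<longrightarrow> \<alpha> \<le> \<beta> \<or> \<beta> \<le> \<alpha>) \<and>
     (\<le>) = (\<lambda>\<alpha> \<beta>. \<alpha> \<le> \<beta> \<and> (\<epsilon> \<alpha> = \<epsilon> \<beta> \<or> dynkin_adjacent A (\<epsilon> \<alpha>) (\<epsilon> \<beta>)))\<^sup>+\<^sup>+"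

definition covers :: "'e::order \<Rightarrow> 'e \<Rightarrow> bool" where
  "covers \<alpha> \<beta> \<longleftrightarrow> \<beta> < \<alpha> \<and> {\<beta><..<\<alpha>} = {}"

definition fibred_heap :: "('p \<Rightarrow> 'p \<Rightarrow> int) \<Rightarrow> ('e::order \<Rightarrow> 'p) \<Rightarrow> bool" where
  "fibred_heap A \<epsilon> \<longleftrightarrow>
     labelled_heap A \<epsilon> \<and>
     (\<forall>p. \<not> bdd_above (\<epsilon> -` {p}) \<and> \<not> bdd_below (\<epsilon> -` {p})) \<and>
     (\<forall>p p' \<alpha>. dynkin_adjacent A p p' \<and> \<epsilon> \<alpha> = p \<longrightarrow>
        (\<exists>\<beta>. \<epsilon> \<beta> = p' \<and> (covers \<alpha> \<beta> \<or> covers \<beta> \<alpha>)))"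

definition full_heap :: "('p \<Rightarrow> 'p \<Rightarrow> int) \<Rightarrow> ('e::order \<Rightarrow> 'p) \<Rightarrow> bool" where
  "full_heap A \<epsilon> \<longleftrightarrow>
     fibred_heap A \<epsilon> \<and>
     (\<forall>p \<alpha> \<beta>. \<alpha> < \<beta> \<and> \<epsilon> \<alpha> = p \<and> \<epsilon> \<beta> = p \<and> {\<alpha><..<\<beta>} \<inter> \<epsilon> -` {p} = {} \<longrightarrow>
        (\<Sum>\<gamma>\<in>{\<alpha><..<\<beta>}. A p (\<epsilon> \<gamma>)) = -2)"

definition heap_ideal :: "'e::order set \<Rightarrow> bool" where
  "heap_ideal I \<longleftrightarrow> (\<forall>\<alpha>\<in>I. \<forall>\<beta>\<le>\<alpha>. \<beta> \<in> I)"

definition proper_ideal :: "('e::order \<Rightarrow> 'p) \<Rightarrow> 'e set \<Rightarrow> bool" where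
  "proper_ideal \<epsilon> I \<longleftrightarrow>
     heap_ideal I \<and> {} \<subset> I \<and> I \<subset> UNIV \<and>
     (\<forall>p. {} \<subset> I \<inter> \<epsilon> -` {p} \<and> I \<inter> \<epsilon> -` {p} \<subset> \<epsilon> -` {p})"


section \<open>The space spanned by the proper ideals and its operators\<close>

text \<open>
  Formal linear combinations are finitely supported functions; the basis vector \<open>v\<^sub>I\<close> is
  \<^term>\<open>Poly_Mapping.single I 1\<close>.
\<close>

definition pm_scale :: "'k::field \<Rightarrow> ('b \<Rightarrow>\<^sub>0 'k) \<Rightarrow> ('b \<Rightarrow>\<^sub>0 'k)" where
  "pm_scale c v = Poly_Mapping.map ((*) c) v"

definition lin_ext :: "('b \<Rightarrow> ('c \<Rightarrow>\<^sub>0 'k)) \<Rightarrow> ('b \<Rightarrow>\<^sub>0 'k::field) \<Rightarrow> ('c \<Rightarrow>\<^sub>0 'k)" where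
  "lin_ext f v = (\<Sum>b\<in>Poly_Mapping.keys v. pm_scale (Poly_Mapping.lookup v b) (f b))"

definition heap_space :: "('e::order \<Rightarrow> 'p) \<Rightarrow> ('e set \<Rightarrow>\<^sub>0 'k::field) set" where
  "heap_space \<epsilon> = {v. Poly_Mapping.keys v \<subseteq> {I. proper_ideal \<epsilon> I}}"

text \<open>
  \<open>L \<succ> I\<close> and \<open>L \<prec> I\<close>. These are meant for finite convex \<open>L\<close> and are only used below for
  one-element sets, which are finite and convex.
\<close>

definition addable :: "'e::order set \<Rightarrow> 'e set \<Rightarrow> bool" where
  "addable L I \<longleftrightarrow> heap_ideal (I \<union> L) \<and> I \<inter> L = {}"

definition removable :: "'e::order set \<Rightarrow> 'e set \<Rightarrow> bool" where
  "removable L I \<longleftrightarrow> L \<subseteq> I \<and> heap_ideal (I - L)"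

definition X_set :: "'e::order set \<Rightarrow> ('e set \<Rightarrow>\<^sub>0 'k::field) \<Rightarrow> ('e set \<Rightarrow>\<^sub>0 'k)" where
  "X_set L = lin_ext (\<lambda>I. if addable L I then Poly_Mapping.single (I \<union> L) 1 else 0)"

definition Y_set :: "'e::order set \<Rightarrow> ('e set \<Rightarrow>\<^sub>0 'k::field) \<Rightarrow> ('e set \<Rightarrow>\<^sub>0 'k)" where
  "Y_set L = lin_ext (\<lambda>I. if removable L I then Poly_Mapping.single (I - L) 1 else 0)"

definition H_set :: "'e::order set \<Rightarrow> ('e set \<Rightarrow>\<^sub>0 'k::field) \<Rightarrow> ('e set \<Rightarrow>\<^sub>0 'k)" where
  "H_set L = lin_ext (\<lambda>I.
     if removable L I \<and> \<not> addable L I then Poly_Mapping.single I 1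
     else if addable L I \<and> \<not> removable L I then - Poly_Mapping.single I 1
     else 0)"

text \<open>
  The sum over all \<open>\<alpha>\<close> with label \<open>p\<close> is infinite, but on each vector of the heap space only
  finitely many terms are nonzero; \<^const>\<open>Sum_any\<close> adds up these terms.
\<close>

definition X_op :: "('e::order \<Rightarrow> 'p) \<Rightarrow> 'p \<Rightarrow> ('e set \<Rightarrow>\<^sub>0 'k::field) \<Rightarrow> ('e set \<Rightarrow>\<^sub>0 'k)" where
  "X_op \<epsilon> p v = Sum_any (\<lambda>\<alpha>. X_set {\<alpha>} v when \<epsilon> \<alpha> = p)"

definition Y_op :: "('e::order \<Rightarrow> 'p) \<Rightarrow> 'p \<Rightarrow> ('e set \<Rightarrow>\<^sub>0 'k::field) \<Rightarrow> ('e set \<Rightarrow>\<^sub>0 'k)" where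
  "Y_op \<epsilon> p v = Sum_any (\<lambda>\<alpha>. Y_set {\<alpha>} v when \<epsilon> \<alpha> = p)"

definition H_op :: "('e::order \<Rightarrow> 'p) \<Rightarrow> 'p \<Rightarrow> ('e set \<Rightarrow>\<^sub>0 'k::field) \<Rightarrow> ('e set \<Rightarrow>\<^sub>0 'k)" where
  "H_op \<epsilon> p v = Sum_any (\<lambda>\<alpha>. H_set {\<alpha>} v when \<epsilon> \<alpha> = p)"


section \<open>Lie algebras and their modules\<close>

record ('k, 'g) lie_alg =
  lie_carrier :: "'g set"
  lie_add :: "'g \<Rightarrow> 'g \<Rightarrow> 'g"
  lie_zero :: "'g"
  lie_scale :: "'k \<Rightarrow> 'g \<Rightarrow> 'g"
  lie_bracket :: "'g \<Rightarrow> 'g \<Rightarrow> 'g"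

locale lie_algebra =
  fixes G :: "('k::field, 'g) lie_alg"
  assumes add_closed: "x \<in> lie_carrier G \<Longrightarrow> y \<in> lie_carrier G \<Longrightarrow> lie_add G x y \<in> lie_carrier G"
    and zero_closed: "lie_zero G \<in> lie_carrier G"
    and scale_closed: "x \<in> lie_carrier G \<Longrightarrow> lie_scale G c x \<in> lie_carrier G"
    and bracket_closed:
      "x \<in> lie_carrier G \<Longrightarrow> y \<in> lie_carrier G \<Longrightarrow> lie_bracket G x y \<in> lie_carrier G"
    and add_assoc:
      "\<lbrakk>x \<in> lie_carrier G; y \<in> lie_carrier G; z \<in> lie_carrier G\<rbrakk> \<Longrightarrow>
       lie_add G (lie_add G x y) z = lie_add G x (lie_add G y z)"
    and add_comm:
      "\<lbrakk>x \<in> lie_carrier G; y \<in> lie_carrier G\<rbrakk> \<Longrightarrow> lie_add G x y = lie_add G y x"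
    and add_zero: "x \<in> lie_carrier G \<Longrightarrow> lie_add G x (lie_zero G) = x"
    and add_minus: "x \<in> lie_carrier G \<Longrightarrow> lie_add G x (lie_scale G (-1) x) = lie_zero G"
    and scale_one: "x \<in> lie_carrier G \<Longrightarrow> lie_scale G 1 x = x"
    and scale_scale:
      "x \<in> lie_carrier G \<Longrightarrow> lie_scale G c (lie_scale G d x) = lie_scale G (c * d) x"
    and scale_add_left:
      "x \<in> lie_carrier G \<Longrightarrow>
       lie_scale G (c + d) x = lie_add G (lie_scale G c x) (lie_scale G d x)"
    and scale_add_right:
      "\<lbrakk>x \<in> lie_carrier G; y \<in> lie_carrier G\<rbrakk> \<Longrightarrow>
       lie_scale G c (lie_add G x y) = lie_add G (lie_scale G c x) (lie_scale G c y)"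
    and bracket_add_left:
      "\<lbrakk>x \<in> lie_carrier G; y \<in> lie_carrier G; z \<in> lie_carrier G\<rbrakk> \<Longrightarrow>
       lie_bracket G (lie_add G x y) z = lie_add G (lie_bracket G x z) (lie_bracket G y z)"
    and bracket_add_right:
      "\<lbrakk>x \<in> lie_carrier G; y \<in> lie_carrier G; z \<in> lie_carrier G\<rbrakk> \<Longrightarrow>
       lie_bracket G x (lie_add G y z) = lie_add G (lie_bracket G x y) (lie_bracket G x z)"
    and bracket_scale_left:
      "\<lbrakk>x \<in> lie_carrier G; y \<in> lie_carrier G\<rbrakk> \<Longrightarrow>
       lie_bracket G (lie_scale G c x) y = lie_scale G c (lie_bracket G x y)"
    and bracket_scale_right:
      "\<lbrakk>x \<in> lie_carrier G; y \<in> lie_carrier G\<rbrakk> \<Longrightarrow>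
       lie_bracket G x (lie_scale G c y) = lie_scale G c (lie_bracket G x y)"
    and bracket_self: "x \<in> lie_carrier G \<Longrightarrow> lie_bracket G x x = lie_zero G"
    and jacobi:
      "\<lbrakk>x \<in> lie_carrier G; y \<in> lie_carrier G; z \<in> lie_carrier G\<rbrakk> \<Longrightarrow>
       lie_add G (lie_bracket G x (lie_bracket G y z))
         (lie_add G (lie_bracket G y (lie_bracket G z x)) (lie_bracket G z (lie_bracket G x y)))
       = lie_zero G"

text \<open>
  Left modules over \<open>G\<close> whose underlying space is the subspace \<open>V\<close> of an ambient vector space.
\<close>

locale lie_module = lie_algebra G + vector_space scale
  for G :: "('k::field, 'g) lie_alg"
    and scale :: "'k \<Rightarrow> 'v::ab_group_add \<Rightarrow> 'v"  (infixr \<open>*s\<close> 75) +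
  fixes V :: "'v set"
    and act :: "'g \<Rightarrow> 'v \<Rightarrow> 'v"
  assumes subspace_V: "subspace V"
    and act_closed: "x \<in> lie_carrier G \<Longrightarrow> v \<in> V \<Longrightarrow> act x v \<in> V"
    and act_add_left:
      "\<lbrakk>x \<in> lie_carrier G; y \<in> lie_carrier G; v \<in> V\<rbrakk> \<Longrightarrow> act (lie_add G x y) v = act x v + act y v"
    and act_scale_left:
      "\<lbrakk>x \<in> lie_carrier G; v \<in> V\<rbrakk> \<Longrightarrow> act (lie_scale G c x) v = c *s act x v"
    and act_add_right:
      "\<lbrakk>x \<in> lie_carrier G; v \<in> V; w \<in> V\<rbrakk> \<Longrightarrow> act x (v + w) = act x v + act x w"
    and act_scale_right:
      "\<lbrakk>x \<in> lie_carrier G; v \<in> V\<rbrakk> \<Longrightarrow> act x (c *s v) = c *s act x v"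
    and act_bracket:
      "\<lbrakk>x \<in> lie_carrier G; y \<in> lie_carrier G; v \<in> V\<rbrakk> \<Longrightarrow>
       act (lie_bracket G x y) v = act x (act y v) - act y (act x v)"


section \<open>Lie algebras given by generators and relations\<close>

datatype ('k, 'g) lie_term =
    Gen 'g
  | Zero
  | Add "('k, 'g) lie_term" "('k, 'g) lie_term"
  | Scale 'k "('k, 'g) lie_term"
  | Bracket "('k, 'g) lie_term" "('k, 'g) lie_term"

text \<open>
  The least congruence on terms that contains the set \<open>R\<close> of defining relations and makes the
  quotient a Lie algebra over \<^typ>\<open>'k\<close>.
\<close>

inductive_set lie_cong ::
    "(('k::field, 'g) lie_term \<times> ('k, 'g) lie_term) set \<Rightarrow>
     (('k, 'g) lie_term \<times> ('k, 'g) lie_term) set"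
  for R :: "(('k, 'g) lie_term \<times> ('k, 'g) lie_term) set" where
  rel: "(s, t) \<in> R \<Longrightarrow> (s, t) \<in> lie_cong R"
| refl: "(s, s) \<in> lie_cong R"
| sym: "(s, t) \<in> lie_cong R \<Longrightarrow> (t, s) \<in> lie_cong R"
| trans: "\<lbrakk>(s, t) \<in> lie_cong R; (t, u) \<in> lie_cong R\<rbrakk> \<Longrightarrow> (s, u) \<in> lie_cong R"
| cong_Add:
    "\<lbrakk>(s, s') \<in> lie_cong R; (t, t') \<in> lie_cong R\<rbrakk> \<Longrightarrow> (Add s t, Add s' t') \<in> lie_cong R"
| cong_Scale: "(s, s') \<in> lie_cong R \<Longrightarrow> (Scale c s, Scale c s') \<in> lie_cong R"
| cong_Bracket:
    "\<lbrakk>(s, s') \<in> lie_cong R; (t, t') \<in> lie_cong R\<rbrakk> \<Longrightarrow> (Bracket s t, Bracket s' t') \<in> lie_cong R"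
| add_assoc: "(Add (Add s t) u, Add s (Add t u)) \<in> lie_cong R"
| add_comm: "(Add s t, Add t s) \<in> lie_cong R"
| add_zero: "(Add s Zero, s) \<in> lie_cong R"
| add_minus: "(Add s (Scale (-1) s), Zero) \<in> lie_cong R"
| scale_one: "(Scale 1 s, s) \<in> lie_cong R"
| scale_scale: "(Scale c (Scale d s), Scale (c * d) s) \<in> lie_cong R"
| scale_add_left: "(Scale (c + d) s, Add (Scale c s) (Scale d s)) \<in> lie_cong R"
| scale_add_right: "(Scale c (Add s t), Add (Scale c s) (Scale c t)) \<in> lie_cong R"
| bracket_add_left: "(Bracket (Add s t) u, Add (Bracket s u) (Bracket t u)) \<in> lie_cong R"
| bracket_add_right: "(Bracket s (Add t u), Add (Bracket s t) (Bracket s u)) \<in> lie_cong R"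
| bracket_scale_left: "(Bracket (Scale c s) t, Scale c (Bracket s t)) \<in> lie_cong R"
| bracket_scale_right: "(Bracket s (Scale c t), Scale c (Bracket s t)) \<in> lie_cong R"
| bracket_self: "(Bracket s s, Zero) \<in> lie_cong R"
| jacobi:
    "(Add (Bracket s (Bracket t u)) (Add (Bracket t (Bracket u s)) (Bracket u (Bracket s t))), Zero)
     \<in> lie_cong R"

definition lie_class ::
    "(('k::field, 'g) lie_term \<times> ('k, 'g) lie_term) set \<Rightarrow>
     ('k, 'g) lie_term \<Rightarrow> ('k, 'g) lie_term set" where
  "lie_class R t = lie_cong R `` {t}"

definition presented_lie_algebra ::
    "(('k::field, 'g) lie_term \<times> ('k, 'g) lie_term) set \<Rightarrow>
     ('k, ('k, 'g) lie_term set) lie_alg" where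
  "presented_lie_algebra R =
     \<lparr> lie_carrier = UNIV // lie_cong R,
       lie_add = (\<lambda>x y. \<Union>s\<in>x. \<Union>t\<in>y. lie_class R (Add s t)),
       lie_zero = lie_class R Zero,
       lie_scale = (\<lambda>c x. \<Union>s\<in>x. lie_class R (Scale c s)),
       lie_bracket = (\<lambda>x y. \<Union>s\<in>x. \<Union>t\<in>y. lie_class R (Bracket s t)) \<rparr>"

datatype 'p chevalley = E 'p | F 'p | H 'p

inductive_set chevalley_serre ::
    "('p \<Rightarrow> 'p \<Rightarrow> int) \<Rightarrow>
     (('k::field, 'p chevalley) lie_term \<times> ('k, 'p chevalley) lie_term) set"
  for A :: "'p \<Rightarrow> 'p \<Rightarrow> int" where
  HH: "(Bracket (Gen (H i)) (Gen (H j)), Zero) \<in> chevalley_serre A"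
| HE: "(Bracket (Gen (H i)) (Gen (E j)), Scale (of_int (A i j)) (Gen (E j))) \<in> chevalley_serre A"
| HF: "(Bracket (Gen (H i)) (Gen (F j)), Scale (- of_int (A i j)) (Gen (F j))) \<in> chevalley_serre A"
| EF: "(Bracket (Gen (E i)) (Gen (F j)), if i = j then Gen (H i) else Zero) \<in> chevalley_serre A"
| serre_E:
    "i \<noteq> j \<Longrightarrow>
     ((Bracket (Gen (E i)) ^^ nat (1 - A i j)) (Gen (E j)), Zero) \<in> chevalley_serre A"
| serre_F:
    "i \<noteq> j \<Longrightarrow>
     ((Bracket (Gen (F i)) ^^ nat (1 - A i j)) (Gen (F j)), Zero) \<in> chevalley_serre A"

definition km_algebra ::
    "('p \<Rightarrow> 'p \<Rightarrow> int) \<Rightarrow> ('k::field, ('k, 'p chevalley) lie_term set) lie_alg" where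
  "km_algebra A = presented_lie_algebra (chevalley_serre A)"

definition km_gen ::
    "('p \<Rightarrow> 'p \<Rightarrow> int) \<Rightarrow> 'p chevalley \<Rightarrow> ('k::field, 'p chevalley) lie_term set" where
  "km_gen A g = lie_class (chevalley_serre A) (Gen g)"


section \<open>The presented algebra is a Lie algebra\<close>

lemma equiv_lie_cong: "equiv UNIV (lie_cong R)"
proof (rule equivI)
  show "refl (lie_cong R)" by (rule refl_onI) (rule lie_cong.refl)
  show "sym (lie_cong R)" by (rule symI) (erule lie_cong.sym)
  show "trans (lie_cong R)" by (rule transI) (erule (1) lie_cong.trans)
qed simp

lemma lie_class_eq_iff: "lie_class R s = lie_class R t \<longleftrightarrow> (s, t) \<in> lie_cong R"
  unfolding lie_class_def by (rule eq_equiv_class_iff[OF equiv_lie_cong]) simp_all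

lemma carrier_presented: "lie_carrier (presented_lie_algebra R) = range (lie_class R)"
  by (auto simp: presented_lie_algebra_def lie_class_def quotient_def)

lemma mem_lie_class: "s' \<in> lie_class R s \<longleftrightarrow> (s, s') \<in> lie_cong R"
  by (simp add: lie_class_def)

lemma self_mem_lie_class: "s \<in> lie_class R s"
  by (simp add: mem_lie_class lie_cong.refl)

lemma UN_eqI:
  assumes "a \<in> S" and "\<And>x. x \<in> S \<Longrightarrow> f x = C"
  shows "(\<Union>x\<in>S. f x) = C"
  using assms by blast

lemma add_presented:
  "lie_add (presented_lie_algebra R) (lie_class R s) (lie_class R t) = lie_class R (Add s t)"
  unfolding presented_lie_algebra_def lie_alg.simps
  by (intro UN_eqI[OF self_mem_lie_class])
    (simp only: lie_class_eq_iff mem_lie_class lie_cong.sym[OF lie_cong.cong_Add])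

lemma bracket_presented:
  "lie_bracket (presented_lie_algebra R) (lie_class R s) (lie_class R t) = lie_class R (Bracket s t)"
  unfolding presented_lie_algebra_def lie_alg.simps
  by (intro UN_eqI[OF self_mem_lie_class])
    (simp only: lie_class_eq_iff mem_lie_class lie_cong.sym[OF lie_cong.cong_Bracket])

lemma scale_presented:
  "lie_scale (presented_lie_algebra R) c (lie_class R s) = lie_class R (Scale c s)"
  unfolding presented_lie_algebra_def lie_alg.simps
  by (intro UN_eqI[OF self_mem_lie_class])
    (simp only: lie_class_eq_iff mem_lie_class lie_cong.sym[OF lie_cong.cong_Scale])

lemma zero_presented: "lie_zero (presented_lie_algebra R) = lie_class R Zero"
  by (simp add: presented_lie_algebra_def)

lemma lie_algebra_presented: "lie_algebra (presented_lie_algebra R)"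
  by (unfold_locales; unfold carrier_presented; (elim imageE)?;
      simp only: add_presented bracket_presented scale_presented zero_presented rangeI
        lie_class_eq_iff; rule lie_cong.add_assoc
        lie_cong.add_comm
        lie_cong.add_zero
        lie_cong.add_minus
        lie_cong.scale_one
        lie_cong.scale_scale
        lie_cong.scale_add_left
        lie_cong.scale_add_right
        lie_cong.bracket_add_left
        lie_cong.bracket_add_right
        lie_cong.bracket_scale_left
        lie_cong.bracket_scale_right
        lie_cong.bracket_self
        lie_cong.jacobi)

lemma vector_space_pm_scale: "vector_space (pm_scale :: 'k::field \<Rightarrow> ('b \<Rightarrow>\<^sub>0 'k) \<Rightarrow> _)"
proof -
  have lookup: "Poly_Mapping.lookup (pm_scale c v) b = c * Poly_Mapping.lookup v b"
    for c :: 'k and v :: "'b \<Rightarrow>\<^sub>0 'k" and b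
    by (simp add: pm_scale_def Poly_Mapping.map.rep_eq when_def)
  show ?thesis
    by unfold_locales
      (auto intro!: poly_mapping_eqI simp: lookup Poly_Mapping.lookup_add algebra_simps)
qed

end

theory Submission
  imports Defs
begin

text \<open>
  Everything rests on the behaviour of one label \<open>p\<close> at one proper ideal \<open>I\<close>.  The elements
  labelled \<open>p\<close> form a chain like the integers, which \<open>I\<close> cuts between two consecutive elements
  \<open>\<alpha> \<in> I\<close> and \<open>\<beta> \<notin> I\<close>.  The Cartan entries \<open>a\<^bsub>p\<epsilon>(\<gamma>)\<^esub>\<close> with
  \<open>\<gamma>\<close> strictly between \<open>\<alpha>\<close> and \<open>\<beta>\<close> are non-positive, and fullness says that they add up to
  \<open>-2\<close>.  Let the weight of \<open>I\<close> at \<open>p\<close> be one plus the sum of those entries whose \<open>\<gamma>\<close> lies in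
  \<open>I\<close>; it is \<open>-1\<close>, \<open>0\<close> or \<open>1\<close>.  Only \<open>\<beta>\<close> can be added to \<open>I\<close>, and this is possible exactly when
  no element between \<open>\<alpha>\<close> and \<open>\<beta>\<close> with a label adjacent to \<open>p\<close> is missing from \<open>I\<close>, that is,
  when the missing entries add up to \<open>0\<close> and those in \<open>I\<close> to \<open>-2\<close>, so that the weight is
  \<open>-1\<close> (lemma \<open>addable_iff\<close>); in the same way \<open>\<alpha>\<close> can be removed exactly when the weight is \<open>1\<close>
  (lemma \<open>removable_iff\<close>).  So \<open>H\<^sub>p\<close> multiplies \<open>v\<^sub>I\<close> by the weight.  Adding an element labelled
  \<open>q\<close> to an ideal changes the weight at \<open>p\<close> by \<open>a\<^sub>p\<^sub>q\<close> (lemma \<open>weight_step\<close>).  Unions and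
  intersections of ideals are ideals, so additions of elements with different labels can be
  interchanged (lemmas \<open>step_join\<close> and \<open>step_meet\<close>).

  The locale \<open>minuscule_system\<close> collects these facts, and they imply every defining relation.
  The relations for \<open>h\<^sub>i\<close> state how the weights change; \<open>[e\<^sub>i, f\<^sub>i] = h\<^sub>i\<close> is a case distinction on
  the weight; \<open>[e\<^sub>i, f\<^sub>j] = 0\<close> for \<open>i \<noteq> j\<close> is the interchange property.  For the Serre relations, two
  consecutive applications of \<open>X\<^sub>i\<close> give zero because the first one leaves weight \<open>1\<close> at \<open>i\<close>.  This
  kills every term of \<open>(ad e\<^sub>i)\<^sup>3(e\<^sub>j)\<close>, and leaves of \<open>(ad e\<^sub>i)\<^sup>2(e\<^sub>j)\<close> only a multiple of
  \<open>X\<^sub>i X\<^sub>j X\<^sub>i\<close>.  If \<open>a\<^sub>i\<^sub>j = -1\<close>, this product vanishes too: after \<open>X\<^sub>i\<close> and \<open>X\<^sub>j\<close> the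
  weight at \<open>i\<close> is \<open>0\<close>.  If \<open>a\<^sub>i\<^sub>j = 0\<close>, then \<open>X\<^sub>i\<close> and \<open>X\<^sub>j\<close> commute.  The relations among the
  \<open>f\<^sub>i\<close> follow by reversing all steps and negating all weights (lemma \<open>dual\<close>).

  A family of linear operators satisfying the defining relations extends to the presented Lie
  algebra by evaluating Lie terms as operators, since this evaluation is constant on the classes
  of the congruence \<^const>\<open>lie_cong\<close> (theorem \<open>presented_lie_module\<close>).
\<close>

section \<open>Representations of presented Lie algebras\<close>

primrec term_op ::
    "('k \<Rightarrow> 'v \<Rightarrow> 'v) \<Rightarrow> ('g \<Rightarrow> 'v \<Rightarrow> 'v) \<Rightarrow> ('k, 'g) lie_term \<Rightarrow> 'v::ab_group_add \<Rightarrow> 'v" where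
  "term_op sc \<rho> (Gen g) = \<rho> g"
| "term_op sc \<rho> Zero = (\<lambda>v. 0)"
| "term_op sc \<rho> (Add s t) = (\<lambda>v. term_op sc \<rho> s v + term_op sc \<rho> t v)"
| "term_op sc \<rho> (Scale c s) = (\<lambda>v. sc c (term_op sc \<rho> s v))"
| "term_op sc \<rho> (Bracket s t) =
     (\<lambda>v. term_op sc \<rho> s (term_op sc \<rho> t v) - term_op sc \<rho> t (term_op sc \<rho> s v))"

text \<open>
  The operators of interest satisfy the relations only on a subspace of the ambient space, hence
  linearity and invariance are relative to a fixed subspace \<open>V\<close>.
\<close>

locale vector_subspace = vector_space scale
  for scale :: "'k::field \<Rightarrow> 'v::ab_group_add \<Rightarrow> 'v" +
  fixes V :: "'v set"
  assumes V: "subspace V"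
begin

definition endo_on :: "('v \<Rightarrow> 'v) \<Rightarrow> bool" where
  "endo_on T \<longleftrightarrow>
     (\<forall>v\<in>V. T v \<in> V) \<and> (\<forall>v\<in>V. \<forall>w\<in>V. T (v + w) = T v + T w) \<and>
     (\<forall>c. \<forall>v\<in>V. T (scale c v) = scale c (T v))"

lemma endo_onD:
  assumes "endo_on T"
  shows "v \<in> V \<Longrightarrow> T v \<in> V"
    and "v \<in> V \<Longrightarrow> w \<in> V \<Longrightarrow> T (v + w) = T v + T w"
    and "v \<in> V \<Longrightarrow> T (scale c v) = scale c (T v)"
  using assms unfolding endo_on_def by auto

lemma endo_on_diff:
  assumes "endo_on T" "v \<in> V" "w \<in> V"
  shows "T (v - w) = T v - T w"
proof -
  have "T ((v - w) + w) = T (v - w) + T w"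
    using assms V by (intro endo_onD(2)) (auto intro: subspace_diff)
  then show ?thesis by (simp add: algebra_simps)
qed

lemma endo_on_zero:
  assumes "endo_on T"
  shows "T 0 = 0"
  using endo_on_diff[OF assms subspace_0[OF V] subspace_0[OF V]] by simp

lemma endo_on_minus:
  assumes "endo_on T" "v \<in> V"
  shows "T (- v) = - T v"
  using endo_onD(3)[OF assms, of "-1"] by simp

lemma endo_on_term_op:
  assumes \<rho>: "\<And>g. endo_on (\<rho> g)"
  shows "endo_on (term_op scale \<rho> s)"
proof (induction s)
  case (Bracket s t)
  then show ?case
    unfolding endo_on_def
    using V by (auto simp: subspace_add subspace_diff subspace_scale scale_right_diff_distrib)
qed (use V \<rho> in \<open>auto simp: endo_on_def subspace_add subspace_scale subspace_0
      scale_right_distrib scale_left_commute\<close>)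

text \<open>
  The Lie algebra axioms built into \<^const>\<open>lie_cong\<close> hold for commutators of operators; invariance
  of \<open>V\<close> is what lets the relations be applied inside a product.
\<close>

lemma term_op_cong:
  assumes \<rho>: "\<And>g. endo_on (\<rho> g)"
    and R: "\<And>s t v. (s, t) \<in> R \<Longrightarrow> v \<in> V \<Longrightarrow> term_op scale \<rho> s v = term_op scale \<rho> t v"
    and "(s, t) \<in> lie_cong R" and "v \<in> V"
  shows "term_op scale \<rho> s v = term_op scale \<rho> t v"
  using assms(3,4)
proof (induction arbitrary: v rule: lie_cong.induct)
  case (rel s t) then show ?case by (rule R)
next
  case (cong_Bracket s s' t t')
  then show ?case
    using endo_onD(1)[OF endo_on_term_op[of \<rho>, OF \<rho>]] by simp
qed (simp_all add: V endo_onD[OF endo_on_term_op[of \<rho>, OF \<rho>]]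
      endo_on_diff[OF endo_on_term_op[of \<rho>, OF \<rho>]] algebra_simps)

theorem presented_lie_module:
  assumes \<rho>: "\<And>g. endo_on (\<rho> g)"
    and R: "\<And>s t v. (s, t) \<in> R \<Longrightarrow> v \<in> V \<Longrightarrow> term_op scale \<rho> s v = term_op scale \<rho> t v"
  shows "\<exists>act. lie_module (presented_lie_algebra R) scale V act \<and>
               (\<forall>g. \<forall>v\<in>V. act (lie_class R (Gen g)) v = \<rho> g v)"
proof -
  define act where "act = (\<lambda>x. term_op scale \<rho> (SOME s. s \<in> x))"
  have act: "act (lie_class R s) v = term_op scale \<rho> s v" if "v \<in> V" for s v
  proof -
    have "(SOME s'. s' \<in> lie_class R s) \<in> lie_class R s"
      by (rule someI) (rule self_mem_lie_class)
    then have "(s, SOME s'. s' \<in> lie_class R s) \<in> lie_cong R"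
      by (simp add: mem_lie_class)
    from term_op_cong[OF \<rho> R this that] show ?thesis
      by (simp add: act_def)
  qed
  note endo = endo_onD[OF endo_on_term_op[of \<rho>, OF \<rho>]]
  interpret G: lie_algebra "presented_lie_algebra R" by (rule lie_algebra_presented)
  have "lie_module (presented_lie_algebra R) scale V act"
    by (unfold_locales; (unfold carrier_presented)?; (elim imageE)?)
       (simp_all add: V act endo add_presented scale_presented bracket_presented
          subspace_add[OF V] subspace_scale[OF V])
  then show ?thesis
    using act by auto
qed

text \<open>
  Expanding \<open>(ad x)\<^bsup>n\<^esup>(y)\<close> gives multiples of the products \<open>x\<^bsup>r\<^esup> y x\<^bsup>n-r\<^esup>\<close>.  When
  \<open>x\<^sup>2 = 0\<close>, only \<open>r \<le> 1\<close> and \<open>n - r \<le> 1\<close> survive: nothing for \<open>n = 3\<close>, and \<open>x y x\<close> for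
  \<open>n = 2\<close>.  For \<open>n = 1\<close> the expression is the commutator of \<open>x\<close> and \<open>y\<close>.
\<close>

lemma serre_bracket_eq_0:
  assumes x: "endo_on (\<rho> a)" and y: "endo_on (\<rho> b)"
    and square: "\<And>v. v \<in> V \<Longrightarrow> \<rho> a (\<rho> a v) = 0"
    and m: "m \<in> {0, -1, -2 :: int}"
    and commute: "\<And>v. m = 0 \<Longrightarrow> v \<in> V \<Longrightarrow> \<rho> a (\<rho> b v) = \<rho> b (\<rho> a v)"
    and triple: "\<And>v. m = -1 \<Longrightarrow> v \<in> V \<Longrightarrow> \<rho> a (\<rho> b (\<rho> a v)) = 0"
    and v: "v \<in> V"
  shows "term_op scale \<rho> ((Bracket (Gen a) ^^ nat (1 - m)) (Gen b)) v = 0"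
proof -
  note [simp] = endo_onD(1)[OF x] endo_onD(1)[OF y] endo_on_diff[OF x] endo_on_diff[OF y]
    endo_on_zero[OF x] endo_on_zero[OF y] subspace_diff[OF V] subspace_0[OF V]
    endo_on_minus[OF x] endo_on_minus[OF y] subspace_neg[OF V] square v
  from m consider "m = 0" | "m = -1" | "m = -2" by auto
  then show ?thesis
  proof cases
    case 1 then show ?thesis using commute by simp
  next
    case 2 then show ?thesis using triple by (simp add: numeral_2_eq_2)
  next
    case 3 then show ?thesis by (simp add: numeral_3_eq_3)
  qed
qed

end

section \<open>Operators on spaces of formal linear combinations\<close>

interpretation pm: vector_space pm_scale
  by (rule vector_space_pm_scale)

definition formal_span :: "'b set \<Rightarrow> ('b \<Rightarrow>\<^sub>0 'k::field) set" where
  "formal_span B = {v. Poly_Mapping.keys v \<subseteq> B}"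

abbreviation basis_vec :: "'b \<Rightarrow> 'b \<Rightarrow>\<^sub>0 'k::field" where
  "basis_vec b \<equiv> Poly_Mapping.single b 1"

lemma lookup_pm_scale: "Poly_Mapping.lookup (pm_scale c v) b = c * Poly_Mapping.lookup v b"
  by (simp add: pm_scale_def Poly_Mapping.map.rep_eq when_def)

lemma subspace_formal_span: "pm.subspace (formal_span B)"
  unfolding pm.subspace_def formal_span_def
  by (auto simp: in_keys_iff lookup_pm_scale Poly_Mapping.lookup_add subset_iff) (metis add.right_neutral)

interpretation fs: vector_subspace pm_scale "formal_span B" for B
  by unfold_locales (rule subspace_formal_span)

lemma basis_vec_in_formal_span: "b \<in> B \<Longrightarrow> basis_vec b \<in> formal_span B"
  by (simp add: formal_span_def)

lemma lin_ext_superset: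
  assumes "finite S" and "Poly_Mapping.keys v \<subseteq> S"
  shows "lin_ext f v = (\<Sum>b\<in>S. pm_scale (Poly_Mapping.lookup v b) (f b))"
  unfolding lin_ext_def using assms
  by (intro sum.mono_neutral_left) (auto simp: in_keys_iff)

lemma lin_ext_add: "lin_ext f (v + w) = lin_ext f v + lin_ext f w"
proof -
  let ?S = "Poly_Mapping.keys v \<union> Poly_Mapping.keys w"
  have "Poly_Mapping.keys (v + w) \<subseteq> ?S" by (rule Poly_Mapping.keys_add)
  then show ?thesis
    by (simp add: lin_ext_superset[of ?S] Poly_Mapping.lookup_add pm.scale_left_distrib sum.distrib)
qed

lemma lin_ext_scale: "lin_ext f (pm_scale c v) = pm_scale c (lin_ext f v)"
proof -
  have "Poly_Mapping.keys (pm_scale c v) \<subseteq> Poly_Mapping.keys v"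
    by (auto simp: in_keys_iff lookup_pm_scale)
  then show ?thesis
    by (simp add: lin_ext_superset[of "Poly_Mapping.keys v"] lookup_pm_scale pm.scale_sum_right)
qed

lemma lin_ext_basis_vec: "lin_ext f (basis_vec b) = f b"
  by (simp add: lin_ext_def)

lemma lin_ext_basis_vec_id: "lin_ext basis_vec v = v"
proof (rule poly_mapping_eqI)
  fix b
  show "Poly_Mapping.lookup (lin_ext basis_vec v) b = Poly_Mapping.lookup v b"
    by (simp add: lin_ext_def lookup_sum lookup_pm_scale lookup_single when_def in_keys_iff
        if_distrib[of "(*) _"] cong: if_cong)
qed

lemma endo_on_lin_extI:
  assumes T: "\<And>v. v \<in> formal_span B \<Longrightarrow> T v = lin_ext g v"
    and g: "\<And>b. b \<in> B \<Longrightarrow> g b \<in> formal_span B"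
  shows "fs.endo_on B T"
proof -
  have "lin_ext g v \<in> formal_span B" if "v \<in> formal_span B" for v
    unfolding lin_ext_def using that g
    by (intro pm.subspace_sum[OF subspace_formal_span] pm.subspace_scale[OF subspace_formal_span])
       (auto simp: formal_span_def)
  then show ?thesis
    by (simp add: fs.endo_on_def T lin_ext_add lin_ext_scale
        pm.subspace_add[OF subspace_formal_span] pm.subspace_scale[OF subspace_formal_span])
qed

lemma endo_on_eq_lin_ext:
  assumes T: "fs.endo_on B T" and v: "v \<in> formal_span B"
  shows "T v = lin_ext (\<lambda>b. T (basis_vec b)) v"
proof -
  note V = subspace_formal_span[of B]
  have "T (\<Sum>b\<in>S. pm_scale (c b) (basis_vec b)) = (\<Sum>b\<in>S. pm_scale (c b) (T (basis_vec b)))"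
    if "finite S" "S \<subseteq> B" for S c
    using that
  proof (induction S rule: finite_induct)
    case empty
    then show ?case by (simp add: fs.endo_on_zero[OF T])
  next
    case (insert b S)
    then have "(\<Sum>b\<in>S. pm_scale (c b) (basis_vec b)) \<in> formal_span B"
      by (intro pm.subspace_sum[OF V] pm.subspace_scale[OF V] basis_vec_in_formal_span) auto
    with insert show ?case
      by (simp add: fs.endo_onD[OF T] pm.subspace_scale[OF V] basis_vec_in_formal_span)
  qed
  from this[of "Poly_Mapping.keys v" "Poly_Mapping.lookup v"] v show ?thesis
    using lin_ext_basis_vec_id[of v] by (simp add: lin_ext_def formal_span_def)
qed

lemma endo_on_eqI:
  assumes "fs.endo_on B S" and "fs.endo_on B T"
    and "\<And>b. b \<in> B \<Longrightarrow> S (basis_vec b) = T (basis_vec b)"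
    and v: "v \<in> formal_span B"
  shows "S v = T v"
proof -
  have "lin_ext (\<lambda>b. S (basis_vec b)) v = lin_ext (\<lambda>b. T (basis_vec b)) v"
    unfolding lin_ext_def using v assms(3)
    by (intro sum.cong) (auto simp: formal_span_def)
  then show ?thesis
    using endo_on_eq_lin_ext[OF assms(1) v] endo_on_eq_lin_ext[OF assms(2) v] by simp
qed

text \<open>
  \<^const>\<open>Sum_any\<close> is zero on infinite supports, so it can be moved inside the linear extension only
  when finitely many summands act on each basis vector occurring in \<open>v\<close>.
\<close>

lemma Sum_any_lin_ext:
  fixes g :: "'a \<Rightarrow> 'b \<Rightarrow> ('c \<Rightarrow>\<^sub>0 'k::field)"
  assumes fin: "\<And>b. b \<in> Poly_Mapping.keys v \<Longrightarrow> finite {a. Q a \<and> g a b \<noteq> 0}"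
  shows "Sum_any (\<lambda>a. lin_ext (g a) v when Q a) = lin_ext (\<lambda>b. Sum_any (\<lambda>a. g a b when Q a)) v"
proof -
  define S where "S = (\<Union>b\<in>Poly_Mapping.keys v. {a. Q a \<and> g a b \<noteq> 0})"
  have S: "finite S" using fin by (simp add: S_def)
  have "lin_ext (g a) v = 0" if "Q a" "a \<notin> S" for a
    unfolding lin_ext_def using that by (intro sum.neutral) (auto simp: S_def)
  then have "Sum_any (\<lambda>a. lin_ext (g a) v when Q a) = (\<Sum>a\<in>S. lin_ext (g a) v when Q a)"
    by (intro Sum_any.expand_superset S) auto
  also have "\<dots> = (\<Sum>a\<in>S. lin_ext (g a) v)"
    by (intro sum.cong) (auto simp: S_def)
  also have "\<dots> = (\<Sum>b\<in>Poly_Mapping.keys v. \<Sum>a\<in>S. pm_scale (Poly_Mapping.lookup v b) (g a b))"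
    unfolding lin_ext_def by (rule sum.swap)
  also have "\<dots> = (\<Sum>b\<in>Poly_Mapping.keys v.
                    pm_scale (Poly_Mapping.lookup v b) (Sum_any (\<lambda>a. g a b when Q a)))"
  proof (rule sum.cong[OF HOL.refl])
    fix b assume b: "b \<in> Poly_Mapping.keys v"
    then have "Sum_any (\<lambda>a. g a b when Q a) = (\<Sum>a\<in>S. g a b when Q a)"
      by (intro Sum_any.expand_superset S) (auto simp: S_def)
    also have "\<dots> = (\<Sum>a\<in>S. g a b)"
      by (intro sum.cong) (auto simp: S_def)
    finally show "(\<Sum>a\<in>S. pm_scale (Poly_Mapping.lookup v b) (g a b)) =
                  pm_scale (Poly_Mapping.lookup v b) (Sum_any (\<lambda>a. g a b when Q a))"
      by (simp add: pm.scale_sum_right)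
  qed
  finally show ?thesis by (simp add: lin_ext_def)
qed

lemma Sum_any_eq_single:
  assumes "\<And>a. a \<noteq> x \<Longrightarrow> f a = 0"
  shows "Sum_any f = f x"
  using assms by (subst Sum_any.expand_superset[of "{x}"]) auto


section \<open>Minuscule systems\<close>

text \<open>
  The linear extension of the partial map with graph \<open>r\<close>.  Encoding the map by its graph turns
  products of operators into relational compositions, and relations between operators into
  equations between graphs.
\<close>

definition shifts_basis :: "'b set \<Rightarrow> ('b \<Rightarrow> 'b \<Rightarrow> bool) \<Rightarrow> (('b \<Rightarrow>\<^sub>0 'k::field) \<Rightarrow> ('b \<Rightarrow>\<^sub>0 'k)) \<Rightarrow> bool" where
  "shifts_basis B r T \<longleftrightarrow> fs.endo_on B T \<and>
     (\<forall>I J. r I J \<longrightarrow> T (basis_vec I) = basis_vec J) \<and>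
     (\<forall>I\<in>B. (\<nexists>J. r I J) \<longrightarrow> T (basis_vec I) = 0)"

lemma shifts_basis_endo: "shifts_basis B r T \<Longrightarrow> fs.endo_on B T"
  by (simp add: shifts_basis_def)

lemma shifts_basis_vec: "shifts_basis B r T \<Longrightarrow> r I J \<Longrightarrow> T (basis_vec I) = basis_vec J"
  by (simp add: shifts_basis_def)

lemma shifts_basis_vec_0: "shifts_basis B r T \<Longrightarrow> I \<in> B \<Longrightarrow> (\<And>J. \<not> r I J) \<Longrightarrow> T (basis_vec I) = 0"
  by (simp add: shifts_basis_def)

lemma shifts_basis_comp:
  assumes S: "shifts_basis B r S" and T: "shifts_basis B r' T"
    and r: "\<And>I J. r I J \<Longrightarrow> J \<in> B"
  shows "shifts_basis B (r OO r') (\<lambda>v. T (S v))"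
  unfolding shifts_basis_def
proof (intro conjI allI ballI impI)
  show "fs.endo_on B (\<lambda>v. T (S v))"
    using shifts_basis_endo[OF S] shifts_basis_endo[OF T] by (simp add: fs.endo_on_def)
next
  fix I J assume "(r OO r') I J"
  then show "T (S (basis_vec I)) = basis_vec J"
    using S T by (auto simp: shifts_basis_vec)
next
  fix I assume I: "I \<in> B" and none: "\<nexists>J. (r OO r') I J"
  show "T (S (basis_vec I)) = 0"
  proof (cases "\<exists>K. r I K")
    case True
    then obtain K where K: "r I K" by blast
    then have "T (basis_vec K) = 0"
      using none r by (intro shifts_basis_vec_0[OF T]) auto
    then show ?thesis by (simp add: shifts_basis_vec[OF S K])
  next
    case False
    then show ?thesis
      using I shifts_basis_vec_0[OF S I] fs.endo_on_zero[OF shifts_basis_endo[OF T]] by simp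
  qed
qed

lemma shifts_basis_unique:
  assumes "shifts_basis B r S" and "shifts_basis B r T" and "v \<in> formal_span B"
  shows "S v = T v"
proof (rule endo_on_eqI[OF shifts_basis_endo[OF assms(1)] shifts_basis_endo[OF assms(2)] _ assms(3)])
  fix I assume "I \<in> B"
  then show "S (basis_vec I) = T (basis_vec I)"
    using assms(1,2) by (cases "\<exists>J. r I J") (auto simp: shifts_basis_def)
qed

lemma shifts_basis_bot:
  assumes T: "shifts_basis B bot T" and "v \<in> formal_span B"
  shows "T v = 0"
  using shifts_basis_unique[OF T _ assms(2), of "\<lambda>v. 0"]
  by (simp add: shifts_basis_def fs.endo_on_def pm.subspace_0[OF subspace_formal_span])

text \<open>
  The combinatorial shadow of a representation in which every \<open>h\<^sub>p\<close> acts diagonally with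
  eigenvalues \<open>-1\<close>, \<open>0\<close>, \<open>1\<close>, and \<open>e\<^sub>p\<close> sends each vector of the basis \<open>B\<close> to another one or
  to zero: \<open>step p I J\<close> says that it sends \<open>v\<^sub>I\<close> to \<open>v\<^sub>J\<close>.  The axioms \<open>join\<close> and \<open>meet\<close> complete a two-sided corner
  to a square, upwards and downwards.
\<close>

locale minuscule_system =
  fixes A :: "'p \<Rightarrow> 'p \<Rightarrow> int"
    and B :: "'b set"
    and step :: "'p \<Rightarrow> 'b \<Rightarrow> 'b \<Rightarrow> bool"
    and wt :: "'p \<Rightarrow> 'b \<Rightarrow> int"
  assumes gcm: "generalized_cartan_matrix A"
    and step_mem: "step p I J \<Longrightarrow> I \<in> B \<and> J \<in> B"
    and step_fun: "step p I J \<Longrightarrow> step p I K \<Longrightarrow> J = K"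
    and step_inj: "step p I K \<Longrightarrow> step p J K \<Longrightarrow> I = J"
    and wt_range: "I \<in> B \<Longrightarrow> wt p I \<in> {-1, 0, 1}"
    and wt_minus_one: "I \<in> B \<Longrightarrow> wt p I = -1 \<longleftrightarrow> (\<exists>J. step p I J)"
    and wt_one: "J \<in> B \<Longrightarrow> wt p J = 1 \<longleftrightarrow> (\<exists>I. step p I J)"
    and wt_step: "step q I J \<Longrightarrow> wt p J = wt p I + A p q"
    and join: "p \<noteq> q \<Longrightarrow> step p I K \<Longrightarrow> step q I L \<Longrightarrow> \<exists>M. step q K M \<and> step p L M"
    and meet: "p \<noteq> q \<Longrightarrow> step p I K \<Longrightarrow> step q L K \<Longrightarrow> \<exists>M. step q M I \<and> step p M L"
begin

text \<open>
  The axioms are symmetric under exchanging raising and lowering.  Every fact about the \<open>e\<^sub>p\<close>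
  therefore also holds for the \<open>f\<^sub>p\<close>.
\<close>

lemma dual: "minuscule_system A B (\<lambda>p. (step p)\<inverse>\<inverse>) (\<lambda>p I. - wt p I)"
proof unfold_locales
  fix I p assume I: "I \<in> B"
  show "- wt p I \<in> {-1, 0, 1}" using wt_range[OF I, of p] by auto
  show "- wt p I = -1 \<longleftrightarrow> (\<exists>J. (step p)\<inverse>\<inverse> I J)" using wt_one[OF I, of p] by auto
  show "- wt p I = 1 \<longleftrightarrow> (\<exists>J. (step p)\<inverse>\<inverse> J I)" using wt_minus_one[OF I, of p] by auto
next
  fix p I J assume "(step p)\<inverse>\<inverse> I J"
  then show "I \<in> B \<and> J \<in> B" using step_mem by blast
next
  fix p q I K L assume "p \<noteq> q" "(step p)\<inverse>\<inverse> I K" "(step q)\<inverse>\<inverse> I L"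
  then show "\<exists>M. (step q)\<inverse>\<inverse> K M \<and> (step p)\<inverse>\<inverse> L M" using meet[of q p L I K] by auto
next
  fix p q I K L assume "p \<noteq> q" "(step p)\<inverse>\<inverse> I K" "(step q)\<inverse>\<inverse> L K"
  then show "\<exists>M. (step q)\<inverse>\<inverse> M I \<and> (step p)\<inverse>\<inverse> M L" using join[of q p K L I] by auto
qed (use gcm step_fun step_inj wt_step in \<open>auto\<close>)

lemma cartan: "p \<noteq> q \<Longrightarrow> A p q \<in> {0, -1, -2}" "A p q = 0 \<longleftrightarrow> A q p = 0"
proof -
  have "A p q \<in> {2, 0, -1, -2}" "p \<noteq> q \<longrightarrow> A p q \<le> 0" "A p q = 0 \<longleftrightarrow> A q p = 0"
    using gcm unfolding generalized_cartan_matrix_def by blast+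
  then show "p \<noteq> q \<Longrightarrow> A p q \<in> {0, -1, -2}" "A p q = 0 \<longleftrightarrow> A q p = 0"
    by auto
qed

lemma step_wt:
  assumes "step p I J"
  shows "wt p I = -1" "wt p J = 1"
  using assms step_mem[OF assms] wt_minus_one wt_one by blast+

text \<open>
  A step at \<open>p\<close> starts at weight \<open>-1\<close> and ends at weight \<open>1\<close>, so no second one can follow at
  once.  If \<open>A p q = -1\<close>, a step at \<open>q\<close> in between lowers the weight only to \<open>0\<close>, which does not
  help.
\<close>

lemma step_square: "step p OO step p = bot"
  using step_wt by (fastforce simp: fun_eq_iff)

lemma step_triple:
  assumes "A p q = -1"
  shows "step p OO step q OO step p = bot"
proof -
  have False if "step p I J" "step q J K" "step p K L" for I J K L
    using step_wt[OF that(1)] step_wt[OF that(3)] wt_step[OF that(2), of p] assms by simp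
  then show ?thesis by (fastforce simp: fun_eq_iff)
qed

text \<open>
  If \<open>A p q = 0\<close>, a step at \<open>q\<close> does not affect the weight at \<open>p\<close>; so a \<open>p\<close>-step possible after
  it was possible before it, and \<open>join\<close> together with uniqueness of targets makes both orders meet.
\<close>

lemma step_commute_le:
  assumes "p \<noteq> q" and "A p q = 0"
  shows "step q OO step p \<le> step p OO step q"
proof (intro predicate2I)
  fix I M assume "(step q OO step p) I M"
  then obtain K where K: "step q I K" "step p K M" by auto
  have "wt p I = -1"
    using wt_step[OF K(1), of p] step_wt(1)[OF K(2)] assms(2) by simp
  then obtain L where L: "step p I L"
    using wt_minus_one step_mem[OF K(1)] by blast
  from join[OF assms(1) L K(1)] obtain M' where "step q L M'" "step p K M'" by blast
  with step_fun[OF K(2)] L show "(step p OO step q) I M" by auto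
qed

lemma step_commute:
  assumes "p \<noteq> q" and "A p q = 0"
  shows "step q OO step p = step p OO step q"
  using assms step_commute_le[of p q] step_commute_le[of q p] cartan(2)[of p q] by (auto intro: antisym)

text \<open>
  Raising along \<open>p\<close> commutes with lowering along a different \<open>q\<close>; one inclusion is \<open>join\<close>, the other
  \<open>meet\<close>.
\<close>

lemma step_converse_commute:
  assumes "p \<noteq> q"
  shows "(step q)\<inverse>\<inverse> OO step p = step p OO (step q)\<inverse>\<inverse>"
  using join[OF assms] meet[OF assms] by (fastforce simp: fun_eq_iff)

lemma serre_relation:
  fixes \<rho> :: "'g \<Rightarrow> ('b \<Rightarrow>\<^sub>0 'k::field) \<Rightarrow> ('b \<Rightarrow>\<^sub>0 'k)"
  assumes x: "shifts_basis B (step p) (\<rho> a)" and y: "shifts_basis B (step q) (\<rho> b)"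
    and "p \<noteq> q" and "v \<in> formal_span B"
  shows "term_op pm_scale \<rho> ((Bracket (Gen a) ^^ nat (1 - A p q)) (Gen b)) v = 0"
proof (rule fs.serre_bracket_eq_0[OF shifts_basis_endo[OF x] shifts_basis_endo[OF y]])
  have mem: "step r I J \<Longrightarrow> J \<in> B" for r I J using step_mem by blast
  fix v :: "'b \<Rightarrow>\<^sub>0 'k" assume v: "v \<in> formal_span B"
  show "\<rho> a (\<rho> a v) = 0"
    using shifts_basis_comp[OF x x mem] v by (intro shifts_basis_bot) (simp_all add: step_square)
  show "\<rho> a (\<rho> b v) = \<rho> b (\<rho> a v)" if "A p q = 0"
    using shifts_basis_comp[OF y x mem] shifts_basis_comp[OF x y mem] v
      step_commute[OF \<open>p \<noteq> q\<close> that]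
    by (intro shifts_basis_unique[of B "step p OO step q" "\<lambda>v. \<rho> a (\<rho> b v)" "\<lambda>v. \<rho> b (\<rho> a v)"]) simp_all
  show "\<rho> a (\<rho> b (\<rho> a v)) = 0" if "A p q = -1"
  proof -
    have "shifts_basis B (step p OO step q OO step p) (\<lambda>v. \<rho> a (\<rho> b (\<rho> a v)))"
      using shifts_basis_comp[OF x shifts_basis_comp[OF y x mem] mem] by simp
    then show ?thesis
      using v by (intro shifts_basis_bot) (simp_all add: step_triple[OF that])
  qed
qed (use assms cartan(1) in auto)

theorem lie_module_of_shifts:
  fixes e f h :: "'p \<Rightarrow> ('b \<Rightarrow>\<^sub>0 'k::field) \<Rightarrow> ('b \<Rightarrow>\<^sub>0 'k)"
  assumes e: "\<And>p. shifts_basis B (step p) (e p)"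
    and f: "\<And>p. shifts_basis B (step p)\<inverse>\<inverse> (f p)"
    and h: "\<And>p. fs.endo_on B (h p)"
    and h_wt: "\<And>p I. I \<in> B \<Longrightarrow> h p (basis_vec I) = pm_scale (of_int (wt p I)) (basis_vec I)"
  shows "\<exists>act. lie_module (km_algebra A :: ('k, ('k, 'p chevalley) lie_term set) lie_alg)
                 pm_scale (formal_span B) act \<and>
           (\<forall>i. \<forall>v \<in> formal_span B.
              act (km_gen A (E i)) v = e i v \<and>
              act (km_gen A (F i)) v = f i v \<and>
              act (km_gen A (H i)) v = h i v)"
proof -
  let ?V = "formal_span B :: ('b \<Rightarrow>\<^sub>0 'k) set"
  define \<rho> where "\<rho> = case_chevalley e f h"
  have \<rho>_simps [simp]: "\<rho> (E i) = e i" "\<rho> (F i) = f i" "\<rho> (H i) = h i" for i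
    by (simp_all add: \<rho>_def)
  have \<rho>: "fs.endo_on B (\<rho> g)" for g
    using shifts_basis_endo[OF e] shifts_basis_endo[OF f] h by (cases g) auto
  interpret dual: minuscule_system A B "\<lambda>p. (step p)\<inverse>\<inverse>" "\<lambda>p I. - wt p I" by (rule dual)
  have mem: "step p I J \<Longrightarrow> I \<in> B" "step p I J \<Longrightarrow> J \<in> B" for p I J
    using step_mem by blast+
  \<comment> \<open>An operator that changes all weights at \<open>i\<close> by \<open>c\<close> is an eigenvector, with eigenvalue \<open>c\<close>, of \<open>ad h\<^sub>i\<close>.
    Both \<open>e\<^sub>j\<close> and \<open>f\<^sub>j\<close> are instances, with opposite \<open>c\<close>.\<close>
  have h_shift: "h i (T v) - T (h i v) = pm_scale (of_int c) (T v)"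
    if T: "shifts_basis B r T" and r: "\<And>I J. r I J \<Longrightarrow> J \<in> B \<and> wt i J = wt i I + c"
      and v: "v \<in> ?V" for i c r T v
  proof (rule endo_on_eqI[OF _ _ _ v])
    note [simp] = fs.endo_onD[OF h] fs.endo_onD[OF shifts_basis_endo[OF T]]
      pm.subspace_diff[OF subspace_formal_span] pm.subspace_scale[OF subspace_formal_span]
      fs.endo_on_zero[OF h]
    show "fs.endo_on B (\<lambda>v. h i (T v) - T (h i v))" "fs.endo_on B (\<lambda>v. pm_scale (of_int c) (T v))"
      by (simp_all add: fs.endo_on_def pm.scale_right_distrib pm.scale_right_diff_distrib
          pm.scale_left_commute)
    fix I assume I: "I \<in> B"
    show "h i (T (basis_vec I)) - T (h i (basis_vec I)) = pm_scale (of_int c) (T (basis_vec I))"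
    proof (cases "\<exists>J. r I J")
      case True
      then obtain J where J: "r I J" by blast
      then show ?thesis
        using r[OF J] I
        by (simp add: h_wt shifts_basis_vec[OF T J] basis_vec_in_formal_span pm.scale_left_distrib)
    next
      case False
      then show ?thesis
        using I shifts_basis_vec_0[OF T I] by (simp add: h_wt basis_vec_in_formal_span)
    qed
  qed
  have ef: "e i (f i v) - f i (e i v) = h i v" if v: "v \<in> ?V" for i v
  proof (rule endo_on_eqI[OF _ h _ v])
    note ee = shifts_basis_endo[OF e, of i] and ff = shifts_basis_endo[OF f, of i]
    note [simp] = fs.endo_onD[OF ee] fs.endo_onD[OF ff]
      pm.subspace_diff[OF subspace_formal_span] pm.subspace_scale[OF subspace_formal_span]
      fs.endo_on_zero[OF ee] fs.endo_on_zero[OF ff]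
    show "fs.endo_on B (\<lambda>v. e i (f i v) - f i (e i v))"
      by (simp add: fs.endo_on_def pm.scale_right_diff_distrib)
    fix I assume I: "I \<in> B"
    consider "wt i I = -1" | "wt i I = 0" | "wt i I = 1" using wt_range[OF I, of i] by auto
    then show "e i (f i (basis_vec I)) - f i (e i (basis_vec I)) = h i (basis_vec I)"
    proof cases
      case 1
      then obtain J where J: "step i I J" using wt_minus_one[OF I] by blast
      have "f i (basis_vec I) = 0"
        using 1 wt_one[OF I, of i] by (intro shifts_basis_vec_0[OF f I]) auto
      moreover have "f i (basis_vec J) = basis_vec I"
        using J by (intro shifts_basis_vec[OF f]) simp
      ultimately show ?thesis
        by (simp add: h_wt[OF I] 1 shifts_basis_vec[OF e J])
    next
      case 2
      have "f i (basis_vec I) = 0"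
        using 2 wt_one[OF I, of i] by (intro shifts_basis_vec_0[OF f I]) auto
      moreover have "e i (basis_vec I) = 0"
        using 2 wt_minus_one[OF I, of i] by (intro shifts_basis_vec_0[OF e I]) auto
      ultimately show ?thesis by (simp add: h_wt[OF I] 2)
    next
      case 3
      then obtain J where J: "step i J I" using wt_one[OF I] by blast
      have "e i (basis_vec I) = 0"
        using 3 wt_minus_one[OF I, of i] by (intro shifts_basis_vec_0[OF e I]) auto
      moreover have "f i (basis_vec I) = basis_vec J"
        using J by (intro shifts_basis_vec[OF f]) simp
      ultimately show ?thesis
        by (simp add: h_wt[OF I] 3 shifts_basis_vec[OF e J])
    qed
  qed
  have "term_op pm_scale \<rho> s v = term_op pm_scale \<rho> t v"
    if "(s, t) \<in> chevalley_serre A" and v: "v \<in> ?V" for s t v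
    using that(1)
  proof cases
    case (HH i j)
    have "h i (h j v) = h j (h i v)"
      by (rule endo_on_eqI[OF _ _ _ v])
         (simp_all add: fs.endo_on_def fs.endo_onD[OF h] h_wt basis_vec_in_formal_span mult.commute)
    then show ?thesis by (simp add: HH)
  next
    case (HE i j)
    then show ?thesis
      using h_shift[OF e _ v, of j i "A i j"] mem wt_step by simp
  next
    case (HF i j)
    then show ?thesis
      using h_shift[OF f _ v, of j i "- A i j"] mem wt_step by fastforce
  next
    case (EF i j)
    show ?thesis
    proof (cases "i = j")
      case True
      then show ?thesis using EF ef[OF v, of i] by simp
    next
      case False
      have "shifts_basis B (step i OO (step j)\<inverse>\<inverse>) (\<lambda>v. e i (f j v))"
        using shifts_basis_comp[OF f[of j] e[of i]] mem step_converse_commute[OF False] by auto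
      moreover have "shifts_basis B (step i OO (step j)\<inverse>\<inverse>) (\<lambda>v. f j (e i v))"
        using shifts_basis_comp[OF e[of i] f[of j]] mem by auto
      ultimately have "e i (f j v) = f j (e i v)"
        using v by (rule shifts_basis_unique)
      then show ?thesis using EF False by simp
    qed
  next
    case (serre_E i j)
    then show ?thesis
      using serre_relation[of i \<rho> "E i" j "E j"] e v by simp
  next
    case (serre_F i j)
    then show ?thesis
      using dual.serre_relation[of i \<rho> "F i" j "F j"] f v by simp
  qed
  from fs.presented_lie_module[of B \<rho>, OF \<rho> this] show ?thesis
    by (metis \<rho>_simps km_algebra_def km_gen_def)
qed

end


section \<open>Proper ideals of a full heap\<close>

locale full_heap_over =
  fixes A :: "'p \<Rightarrow> 'p \<Rightarrow> int"
    and \<epsilon> :: "'e::order \<Rightarrow> 'p"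
  assumes gcm: "generalized_cartan_matrix A"
    and full: "full_heap A \<epsilon>"
begin

abbreviation linked :: "'e \<Rightarrow> 'e \<Rightarrow> bool" where
  "linked \<alpha> \<beta> \<equiv> \<epsilon> \<alpha> = \<epsilon> \<beta> \<or> dynkin_adjacent A (\<epsilon> \<alpha>) (\<epsilon> \<beta>)"

lemma fibred: "fibred_heap A \<epsilon>" and heap: "labelled_heap A \<epsilon>"
  using full by (auto simp: full_heap_def fibred_heap_def)

lemma finite_interval: "finite {\<alpha>..\<beta> :: 'e}"
  using heap by (simp add: labelled_heap_def)

lemma linked_comparable: "linked \<alpha> \<beta> \<Longrightarrow> \<alpha> \<le> \<beta> \<or> \<beta> \<le> \<alpha>"
  using heap unfolding labelled_heap_def by blast

lemma le_eq_chains: "(\<le>) = (\<lambda>\<alpha> \<beta>. \<alpha> \<le> \<beta> \<and> linked \<alpha> \<beta>)\<^sup>+\<^sup>+"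
  using heap unfolding labelled_heap_def by blast

lemma linked_sym: "linked \<alpha> \<beta> \<longleftrightarrow> linked \<beta> \<alpha>"
  using gcm unfolding dynkin_adjacent_def generalized_cartan_matrix_def by metis

text \<open>
  The order is generated by comparisons between elements with equal or adjacent labels.  Any strict
  inequality can thus be refined by a linked one at its upper end, and likewise at its lower end.
  This reduces the question whether adding or removing an element leaves an ideal to the elements
  of adjacent label.
\<close>

lemma last_link:
  assumes "\<alpha> < \<beta>"
  shows "\<exists>\<gamma>. \<alpha> \<le> \<gamma> \<and> \<gamma> < \<beta> \<and> linked \<gamma> \<beta>"
proof -
  have "(\<lambda>\<alpha> \<beta>. \<alpha> \<le> \<beta> \<and> linked \<alpha> \<beta>)\<^sup>+\<^sup>+ \<alpha> \<beta>"
    using assms le_eq_chains by (metis less_imp_le)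
  then have "\<alpha> \<le> \<beta> \<and> (\<alpha> \<noteq> \<beta> \<longrightarrow> (\<exists>\<gamma>. \<alpha> \<le> \<gamma> \<and> \<gamma> < \<beta> \<and> linked \<gamma> \<beta>))"
  proof (induction rule: tranclp_induct)
    case (base \<beta>)
    then show ?case by (auto simp: order.strict_iff_order)
  next
    case (step \<gamma> \<beta>)
    then show ?case
      by (cases "\<gamma> = \<beta>") (auto simp: order.strict_iff_order)
  qed
  with assms show ?thesis by auto
qed

lemma first_link:
  assumes "\<alpha> < \<beta>"
  shows "\<exists>\<gamma>. \<alpha> < \<gamma> \<and> \<gamma> \<le> \<beta> \<and> linked \<alpha> \<gamma>"
proof -
  have "(\<lambda>\<alpha> \<beta>. \<alpha> \<le> \<beta> \<and> linked \<alpha> \<beta>)\<^sup>+\<^sup>+ \<alpha> \<beta>"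
    using assms le_eq_chains by (metis less_imp_le)
  then have "\<alpha> \<le> \<beta> \<and> (\<alpha> \<noteq> \<beta> \<longrightarrow> (\<exists>\<gamma>. \<alpha> < \<gamma> \<and> \<gamma> \<le> \<beta> \<and> linked \<alpha> \<gamma>))"
  proof (induction rule: converse_tranclp_induct)
    case (base \<alpha>)
    then show ?case by (auto simp: order.strict_iff_order)
  next
    case (step \<alpha> \<gamma>)
    then show ?case
      by (cases "\<alpha> = \<gamma>") (auto simp: order.strict_iff_order)
  qed
  with assms show ?thesis by auto
qed

lemma fibre_unbounded:
  shows "\<exists>\<beta>. \<epsilon> \<beta> = p \<and> \<not> \<beta> \<le> \<alpha>" and "\<exists>\<beta>. \<epsilon> \<beta> = p \<and> \<not> \<alpha> \<le> \<beta>"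
  using fibred unfolding fibred_heap_def bdd_above_def bdd_below_def by fastforce+

lemma ideal_down: "heap_ideal I \<Longrightarrow> \<alpha> \<in> I \<Longrightarrow> \<beta> \<le> \<alpha> \<Longrightarrow> \<beta> \<in> I"
  by (auto simp: heap_ideal_def)

lemma proper_ideal_iff:
  "proper_ideal \<epsilon> I \<longleftrightarrow>
     heap_ideal I \<and> (\<forall>p. (\<exists>\<alpha>\<in>I. \<epsilon> \<alpha> = p) \<and> (\<exists>\<beta>. \<beta> \<notin> I \<and> \<epsilon> \<beta> = p))"
  unfolding proper_ideal_def by blast

text \<open>
  The consecutive elements \<open>\<alpha>\<close>, \<open>\<beta>\<close> between which the ideal \<open>I\<close> cuts the chain of elements
  labelled \<open>p\<close>.
\<close>

definition fibre_cut :: "'p \<Rightarrow> 'e set \<Rightarrow> 'e \<Rightarrow> 'e \<Rightarrow> bool" where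
  "fibre_cut p I \<alpha> \<beta> \<longleftrightarrow> \<alpha> \<in> I \<and> \<epsilon> \<alpha> = p \<and> \<beta> \<notin> I \<and> \<epsilon> \<beta> = p \<and>
     (\<forall>\<gamma>\<in>I. \<epsilon> \<gamma> = p \<longrightarrow> \<gamma> \<le> \<alpha>) \<and> (\<forall>\<gamma>. \<gamma> \<notin> I \<longrightarrow> \<epsilon> \<gamma> = p \<longrightarrow> \<beta> \<le> \<gamma>)"

text \<open>
  Properness gives elements labelled \<open>p\<close> inside and outside \<open>I\<close>; the interval between them is
  finite, so the largest inside and the smallest outside exist.
\<close>

lemma ex_fibre_cut:
  assumes I: "proper_ideal \<epsilon> I"
  shows "\<exists>\<alpha> \<beta>. fibre_cut p I \<alpha> \<beta>"
proof -
  have id: "heap_ideal I" using I by (simp add: proper_ideal_iff)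
  obtain a b where a: "a \<in> I" "\<epsilon> a = p" and b: "b \<notin> I" "\<epsilon> b = p"
    using I unfolding proper_ideal_iff by meson
  have below: "\<gamma> \<le> \<delta>" if "\<gamma> \<in> I" "\<delta> \<notin> I" "\<epsilon> \<gamma> = p" "\<epsilon> \<delta> = p" for \<gamma> \<delta>
    using linked_comparable[of \<gamma> \<delta>] ideal_down[OF id] that by metis
  let ?L = "{\<gamma> \<in> I. \<epsilon> \<gamma> = p \<and> a \<le> \<gamma>}" and ?U = "{\<gamma>. \<gamma> \<notin> I \<and> \<epsilon> \<gamma> = p \<and> \<gamma> \<le> b}"
  have "?L \<subseteq> {a..b}" "?U \<subseteq> {a..b}" using below a b by auto
  then have fin: "finite ?L" "finite ?U" using finite_interval finite_subset by blast+
  obtain \<alpha> where \<alpha>: "\<alpha> \<in> ?L" "\<And>\<gamma>. \<gamma> \<in> ?L \<Longrightarrow> \<alpha> \<le> \<gamma> \<Longrightarrow> \<gamma> = \<alpha>"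
    using finite_has_maximal[OF fin(1)] a by blast
  obtain \<beta> where \<beta>: "\<beta> \<in> ?U" "\<And>\<gamma>. \<gamma> \<in> ?U \<Longrightarrow> \<gamma> \<le> \<beta> \<Longrightarrow> \<gamma> = \<beta>"
    using finite_has_minimal[OF fin(2)] b by blast
  have "\<gamma> \<le> \<alpha>" if "\<gamma> \<in> I" "\<epsilon> \<gamma> = p" for \<gamma>
    using linked_comparable[of \<gamma> \<alpha>] \<alpha> that by (auto dest: order.trans)
  moreover have "\<beta> \<le> \<gamma>" if "\<gamma> \<notin> I" "\<epsilon> \<gamma> = p" for \<gamma>
    using linked_comparable[of \<gamma> \<beta>] \<beta> that by (auto dest: order.trans)
  ultimately have "fibre_cut p I \<alpha> \<beta>"
    using \<alpha>(1) \<beta>(1) by (auto simp: fibre_cut_def)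
  then show ?thesis by blast
qed

text \<open>
  The open interval between the two elements of the cut, described without choosing them.  In this
  form it visibly depends only on which elements labelled \<open>p\<close> lie in \<open>I\<close>.
\<close>

definition gap :: "'p \<Rightarrow> 'e set \<Rightarrow> 'e set" where
  "gap p I = {\<gamma>. (\<forall>\<alpha>\<in>I. \<epsilon> \<alpha> = p \<longrightarrow> \<alpha> < \<gamma>) \<and> (\<forall>\<beta>. \<beta> \<notin> I \<longrightarrow> \<epsilon> \<beta> = p \<longrightarrow> \<gamma> < \<beta>)}"

text \<open>
  The eigenvalue of \<open>H\<^sub>p\<close> on \<open>v\<^sub>I\<close>, as \<open>H_op_basis_vec\<close> below confirms.
\<close>

definition weight :: "'p \<Rightarrow> 'e set \<Rightarrow> int" where
  "weight p I = 1 + (\<Sum>\<gamma>\<in>gap p I \<inter> I. A p (\<epsilon> \<gamma>))"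

lemma gap_eq: "fibre_cut p I \<alpha> \<beta> \<Longrightarrow> gap p I = {\<alpha><..<\<beta>}"
  unfolding gap_def fibre_cut_def by (auto intro: le_less_trans less_le_trans)

context
  fixes I :: "'e set" and p :: 'p and \<alpha> \<beta> :: 'e
  assumes I: "proper_ideal \<epsilon> I" and cut: "fibre_cut p I \<alpha> \<beta>"
begin

lemma cut_less: "\<alpha> < \<beta>"
proof -
  have "\<alpha> \<in> I" "\<beta> \<notin> I" "\<epsilon> \<alpha> = \<epsilon> \<beta>" using cut by (auto simp: fibre_cut_def)
  then show ?thesis
    using linked_comparable[of \<alpha> \<beta>] ideal_down[of I \<alpha> \<beta>] I
    by (auto simp: proper_ideal_iff order.strict_iff_order)
qed

lemma finite_gap: "finite (gap p I)"
  using finite_interval[of \<alpha> \<beta>] by (rule finite_subset[rotated]) (auto simp: gap_eq[OF cut])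

lemma gap_label: "\<gamma> \<in> gap p I \<Longrightarrow> \<epsilon> \<gamma> \<noteq> p"
  by (cases "\<gamma> \<in> I") (auto simp: gap_def)

lemma gap_nonpos: "\<gamma> \<in> gap p I \<Longrightarrow> A p (\<epsilon> \<gamma>) \<le> 0"
  using gap_label[of \<gamma>] gcm by (metis generalized_cartan_matrix_def)

lemma gap_sum:
  "(\<Sum>\<gamma>\<in>gap p I \<inter> I. A p (\<epsilon> \<gamma>)) + (\<Sum>\<gamma>\<in>gap p I - I. A p (\<epsilon> \<gamma>)) = -2"
proof -
  have "{\<alpha><..<\<beta>} \<inter> \<epsilon> -` {p} = {}"
    using gap_label unfolding gap_eq[OF cut] by blast
  then have "(\<Sum>\<gamma>\<in>gap p I. A p (\<epsilon> \<gamma>)) = -2"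
    using full cut_less cut unfolding full_heap_def gap_eq[OF cut] fibre_cut_def by blast
  then show ?thesis
    using sum.Int_Diff[OF finite_gap, of "\<lambda>\<gamma>. A p (\<epsilon> \<gamma>)" I] by simp
qed

text \<open>
  A sum of non-positive terms vanishes only if each term does.  By \<open>gap_sum\<close> the part of the sum
  outside \<open>I\<close> vanishes exactly when the part inside is \<open>-2\<close>, which is weight \<open>-1\<close>.
\<close>

lemma weight_eq_1_iff: "weight p I = 1 \<longleftrightarrow> (\<forall>\<gamma>\<in>gap p I \<inter> I. A p (\<epsilon> \<gamma>) = 0)"
proof -
  have "(\<Sum>\<gamma>\<in>gap p I \<inter> I. - A p (\<epsilon> \<gamma>)) = 0 \<longleftrightarrow> (\<forall>\<gamma>\<in>gap p I \<inter> I. - A p (\<epsilon> \<gamma>) = 0)"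
    using finite_gap gap_nonpos by (intro sum_nonneg_eq_0_iff) auto
  then show ?thesis by (simp add: weight_def sum_negf)
qed

lemma weight_eq_minus_1_iff: "weight p I = -1 \<longleftrightarrow> (\<forall>\<gamma>\<in>gap p I - I. A p (\<epsilon> \<gamma>) = 0)"
proof -
  have "(\<Sum>\<gamma>\<in>gap p I - I. - A p (\<epsilon> \<gamma>)) = 0 \<longleftrightarrow> (\<forall>\<gamma>\<in>gap p I - I. - A p (\<epsilon> \<gamma>) = 0)"
    using finite_gap gap_nonpos by (intro sum_nonneg_eq_0_iff) auto
  then show ?thesis using gap_sum by (auto simp: weight_def sum_negf)
qed

lemma weight_bounds: "weight p I \<in> {-1, 0, 1}"
proof -
  have "(\<Sum>\<gamma>\<in>gap p I \<inter> I. A p (\<epsilon> \<gamma>)) \<le> 0" "(\<Sum>\<gamma>\<in>gap p I - I. A p (\<epsilon> \<gamma>)) \<le> 0"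
    using gap_nonpos by (auto intro!: sum_nonpos)
  with gap_sum show ?thesis by (auto simp: weight_def)
qed

text \<open>
  An obstruction to adding \<open>\<beta>\<close> is some element below \<open>\<beta>\<close> outside \<open>I\<close>.  Climbing from it along
  the order, the last link before \<open>\<beta>\<close> has a label equal or adjacent to \<open>p\<close> and is still outside
  \<open>I\<close>; by the choice of the cut its label is not \<open>p\<close>, and it lies above \<open>\<alpha>\<close>.  So it is an
  element of the gap that contributes to the part of the sum outside \<open>I\<close>.
\<close>

lemma addable_iff:
  assumes "\<epsilon> x = p"
  shows "addable {x} I \<longleftrightarrow> x = \<beta> \<and> weight p I = -1"
proof safe
  assume add: "addable {x} I"
  show x: "x = \<beta>"
    using add assms cut unfolding addable_def fibre_cut_def heap_ideal_def by blast
  have "gap p I - I = {}"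
  proof -
    have "\<gamma> \<in> I" if "\<gamma> < \<beta>" for \<gamma>
      using add that ideal_down[of "I \<union> {\<beta>}" \<beta> \<gamma>] unfolding x addable_def
      by (auto simp: order.strict_iff_order)
    then show ?thesis by (auto simp: gap_eq[OF cut])
  qed
  then show "weight p I = -1" by (auto simp: weight_eq_minus_1_iff)
next
  assume w: "weight p I = -1"
  have "\<gamma> \<in> I" if less: "\<gamma> < \<beta>" for \<gamma>
  proof (rule ccontr)
    assume \<gamma>: "\<gamma> \<notin> I"
    obtain \<delta> where \<delta>: "\<gamma> \<le> \<delta>" "\<delta> < \<beta>" "linked \<delta> \<beta>" using last_link[OF less] by blast
    have "\<delta> \<notin> I" using ideal_down \<delta>(1) \<gamma> I by (auto simp: proper_ideal_iff)
    have "\<epsilon> \<delta> \<noteq> p" using cut \<open>\<delta> \<notin> I\<close> \<delta>(2) unfolding fibre_cut_def by force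
    then have adj: "A p (\<epsilon> \<delta>) \<noteq> 0" and "linked \<alpha> \<delta>"
      using \<delta>(3) cut linked_sym[of \<delta> \<beta>] unfolding fibre_cut_def dynkin_adjacent_def by auto
    then have "\<alpha> < \<delta>"
      using linked_comparable[of \<alpha> \<delta>] ideal_down[of I \<alpha> \<delta>] I cut \<open>\<delta> \<notin> I\<close>
      by (auto simp: proper_ideal_iff fibre_cut_def order.strict_iff_order)
    then have "\<delta> \<in> gap p I - I" using \<delta>(2) \<open>\<delta> \<notin> I\<close> by (simp add: gap_eq[OF cut])
    with w adj show False by (auto simp: weight_eq_minus_1_iff)
  qed
  then show "addable {\<beta>} I"
    using I cut unfolding addable_def heap_ideal_def proper_ideal_iff fibre_cut_def
    by (auto simp: order.order_iff_strict)
qed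

text \<open>
  The order-dual argument: an obstruction to removing \<open>\<alpha>\<close> yields an adjacent element of \<open>I\<close> in the
  gap.
\<close>

lemma removable_iff:
  assumes "\<epsilon> x = p"
  shows "removable {x} I \<longleftrightarrow> x = \<alpha> \<and> weight p I = 1"
proof safe
  assume rem: "removable {x} I"
  show x: "x = \<alpha>"
    using rem assms cut unfolding removable_def fibre_cut_def heap_ideal_def by blast
  have "gap p I \<inter> I = {}"
  proof -
    have "\<gamma> \<notin> I" if "\<alpha> < \<gamma>" for \<gamma>
      using rem that ideal_down[of "I - {\<alpha>}" \<gamma> \<alpha>] unfolding x removable_def
      by (auto simp: order.strict_iff_order)
    then show ?thesis by (auto simp: gap_eq[OF cut])
  qed
  then show "weight p I = 1" by (auto simp: weight_eq_1_iff)
next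
  assume w: "weight p I = 1"
  have "\<gamma> \<notin> I" if less: "\<alpha> < \<gamma>" for \<gamma>
  proof
    assume \<gamma>: "\<gamma> \<in> I"
    obtain \<delta> where \<delta>: "\<alpha> < \<delta>" "\<delta> \<le> \<gamma>" "linked \<alpha> \<delta>" using first_link[OF less] by blast
    have "\<delta> \<in> I" using ideal_down \<delta>(2) \<gamma> I by (auto simp: proper_ideal_iff)
    have "\<epsilon> \<delta> \<noteq> p" using cut \<open>\<delta> \<in> I\<close> \<delta>(1) unfolding fibre_cut_def by force
    then have adj: "A p (\<epsilon> \<delta>) \<noteq> 0" and "linked \<beta> \<delta>"
      using \<delta>(3) cut unfolding fibre_cut_def dynkin_adjacent_def by auto
    then have "\<delta> < \<beta>"
      using linked_comparable[of \<beta> \<delta>] ideal_down[of I \<delta> \<beta>] I cut \<open>\<delta> \<in> I\<close>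
      by (auto simp: proper_ideal_iff fibre_cut_def order.strict_iff_order)
    then have "\<delta> \<in> gap p I \<inter> I" using \<delta>(1) \<open>\<delta> \<in> I\<close> by (simp add: gap_eq[OF cut])
    with w adj show False by (auto simp: weight_eq_1_iff)
  qed
  then show "removable {\<alpha>} I"
    using I cut unfolding removable_def heap_ideal_def proper_ideal_iff fibre_cut_def
    by (auto simp: order.order_iff_strict)
qed

end

definition step :: "'p \<Rightarrow> 'e set \<Rightarrow> 'e set \<Rightarrow> bool" where
  "step p I J \<longleftrightarrow> proper_ideal \<epsilon> I \<and> proper_ideal \<epsilon> J \<and> (\<exists>x. x \<notin> I \<and> \<epsilon> x = p \<and> J = insert x I)"

text \<open>
  The chains are unbounded, so adding or removing a single element cannot exhaust the part of a
  chain outside or inside a proper ideal.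
\<close>

lemma step_insertI:
  assumes I: "proper_ideal \<epsilon> I" and x: "addable {x} I" "\<epsilon> x = p"
  shows "step p I (insert x I)"
proof -
  have id: "heap_ideal (insert x I)" and "x \<notin> I" using x by (auto simp: addable_def)
  have "\<exists>\<beta>. \<beta> \<notin> insert x I \<and> \<epsilon> \<beta> = q" for q
  proof -
    obtain \<beta> where \<beta>: "\<epsilon> \<beta> = q" "\<beta> \<notin> I" using I unfolding proper_ideal_iff by meson
    obtain \<delta> where \<delta>: "\<epsilon> \<delta> = q" "\<not> \<delta> \<le> \<beta>" using fibre_unbounded(1) by blast
    then have "\<beta> < \<delta>" using linked_comparable[of \<beta> \<delta>] \<beta> by (auto simp: order.strict_iff_order)
    then have "\<delta> \<notin> I" using \<beta>(2) I ideal_down[of I \<delta> \<beta>] by (auto simp: proper_ideal_iff order.strict_iff_order)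
    show ?thesis
    proof (cases "\<beta> = x")
      case True
      then show ?thesis using \<open>\<beta> < \<delta>\<close> \<delta>(1) \<open>\<delta> \<notin> I\<close> by auto
    qed (use \<beta> in auto)
  qed
  then have "proper_ideal \<epsilon> (insert x I)"
    using I id unfolding proper_ideal_iff by blast
  then show ?thesis using I \<open>x \<notin> I\<close> x(2) unfolding step_def by blast
qed

lemma step_removeI:
  assumes I: "proper_ideal \<epsilon> I" and x: "removable {x} I" "\<epsilon> x = p"
  shows "step p (I - {x}) I"
proof -
  have id: "heap_ideal (I - {x})" and "x \<in> I" using x by (auto simp: removable_def)
  have "\<exists>\<alpha>\<in>I - {x}. \<epsilon> \<alpha> = q" for q
  proof -
    obtain \<alpha> where \<alpha>: "\<epsilon> \<alpha> = q" "\<alpha> \<in> I" using I unfolding proper_ideal_iff by meson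
    obtain \<delta> where \<delta>: "\<epsilon> \<delta> = q" "\<not> \<alpha> \<le> \<delta>" using fibre_unbounded(2) by blast
    then have "\<delta> < \<alpha>" using linked_comparable[of \<alpha> \<delta>] \<alpha> by (auto simp: order.strict_iff_order)
    then have "\<delta> \<in> I" using \<alpha>(2) I ideal_down[of I \<alpha> \<delta>] by (auto simp: proper_ideal_iff order.strict_iff_order)
    show ?thesis
    proof (cases "\<alpha> = x")
      case True
      then show ?thesis using \<open>\<delta> < \<alpha>\<close> \<delta>(1) \<open>\<delta> \<in> I\<close> by auto
    qed (use \<alpha> in auto)
  qed
  then have "proper_ideal \<epsilon> (I - {x})"
    using I id unfolding proper_ideal_iff by blast
  then show ?thesis using I \<open>x \<in> I\<close> x(2) unfolding step_def by blast
qed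

lemma step_iff_addable:
  "step p I J \<longleftrightarrow> proper_ideal \<epsilon> I \<and> (\<exists>x. addable {x} I \<and> \<epsilon> x = p \<and> J = insert x I)"
proof
  assume "step p I J"
  then show "proper_ideal \<epsilon> I \<and> (\<exists>x. addable {x} I \<and> \<epsilon> x = p \<and> J = insert x I)"
    by (auto simp: step_def addable_def proper_ideal_iff)
qed (auto intro: step_insertI)

lemma step_iff_removable:
  "step p I J \<longleftrightarrow> proper_ideal \<epsilon> J \<and> (\<exists>x. removable {x} J \<and> \<epsilon> x = p \<and> I = J - {x})"
proof
  assume "step p I J"
  then show "proper_ideal \<epsilon> J \<and> (\<exists>x. removable {x} J \<and> \<epsilon> x = p \<and> I = J - {x})"
    by (auto simp: step_def removable_def proper_ideal_iff)
qed (auto intro: step_removeI)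

lemma ideal_Un: "heap_ideal I \<Longrightarrow> heap_ideal J \<Longrightarrow> heap_ideal (I \<union> J)"
  and ideal_Int: "heap_ideal I \<Longrightarrow> heap_ideal J \<Longrightarrow> heap_ideal (I \<inter> J)"
  unfolding heap_ideal_def by blast+

lemma step_weight_iff:
  assumes I: "proper_ideal \<epsilon> I"
  shows "weight p I = -1 \<longleftrightarrow> (\<exists>J. step p I J)" and "weight p I = 1 \<longleftrightarrow> (\<exists>J. step p J I)"
proof -
  obtain \<alpha> \<beta> where cut: "fibre_cut p I \<alpha> \<beta>" using ex_fibre_cut[OF I] by blast
  then have "\<epsilon> \<alpha> = p" "\<epsilon> \<beta> = p" by (auto simp: fibre_cut_def)
  then show "weight p I = -1 \<longleftrightarrow> (\<exists>J. step p I J)" "weight p I = 1 \<longleftrightarrow> (\<exists>J. step p J I)"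
    using I addable_iff[OF I cut] removable_iff[OF I cut] step_iff_addable step_iff_removable by metis+
qed

text \<open>
  If \<open>p = q\<close>, the weight passes from \<open>-1\<close> to \<open>1 = -1 + A p p\<close>.  Otherwise the cut at \<open>p\<close> does not
  move, and the new element, comparable to both ends of the cut when \<open>q\<close> is adjacent to \<open>p\<close>, falls
  into the gap and contributes \<open>A p q\<close>.  For other labels \<open>q\<close> the entry \<open>A p q\<close> is \<open>0\<close>, wherever
  the new element lies.
\<close>

lemma weight_step:
  assumes st: "step q I J"
  shows "weight p J = weight p I + A p q"
proof (cases "p = q")
  case True
  have "weight q I = -1" "weight q J = 1"
    using st step_weight_iff by (auto simp: step_def)
  then show ?thesis
    using True gcm by (simp add: generalized_cartan_matrix_def)
next
  case False
  from st obtain x where I: "proper_ideal \<epsilon> I" and J: "proper_ideal \<epsilon> J"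
    and x: "x \<notin> I" "\<epsilon> x = q" "J = insert x I" by (auto simp: step_def)
  obtain \<alpha> \<beta> where cut: "fibre_cut p I \<alpha> \<beta>" using ex_fibre_cut[OF I] by blast
  have gap: "gap p J = gap p I" using x False by (auto simp: gap_def)
  have near: "x \<in> gap p I" if "A p q \<noteq> 0"
  proof -
    have "linked \<alpha> x" "linked \<beta> x"
      using that False x cut by (auto simp: fibre_cut_def dynkin_adjacent_def)
    then have "\<alpha> < x" "x < \<beta>"
      using linked_comparable[of \<alpha> x] linked_comparable[of \<beta> x] x cut False
        ideal_down[of I \<alpha> x] ideal_down[of J x \<beta>] I J
      by (auto simp: fibre_cut_def proper_ideal_iff order.strict_iff_order)
    then show ?thesis by (simp add: gap_eq[OF cut])
  qed
  show ?thesis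
  proof (cases "x \<in> gap p I")
    case True
    then have "gap p J \<inter> J = insert x (gap p I \<inter> I)" using x(3) gap by auto
    then show ?thesis
      using x finite_gap[OF I cut] by (simp add: weight_def)
  next
    case False
    then have "gap p J \<inter> J = gap p I \<inter> I" using x(3) gap by auto
    then show ?thesis using near False by (auto simp: weight_def)
  qed
qed

text \<open>
  The square above two additions is closed by the union of the two ideals, the square below two
  removals by their intersection.
\<close>

lemma step_join:
  assumes "p \<noteq> q" and K: "step p I K" and L: "step q I L"
  shows "\<exists>M. step q K M \<and> step p L M"
proof -
  obtain x where x: "x \<notin> I" "\<epsilon> x = p" "K = insert x I" using K by (auto simp: step_def)
  obtain y where y: "y \<notin> I" "\<epsilon> y = q" "L = insert y I" using L by (auto simp: step_def)
  have proper: "proper_ideal \<epsilon> K" "proper_ideal \<epsilon> L" using K L by (auto simp: step_def)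
  have "insert x (insert y I) = K \<union> L" using x y by auto
  then have "heap_ideal (insert x (insert y I))"
    using proper by (auto simp: proper_ideal_iff intro: ideal_Un)
  then have "addable {y} K" "addable {x} L"
    using x y assms(1) by (auto simp: addable_def insert_commute)
  then have "step q K (insert y K)" "step p L (insert x L)"
    using proper x y by (auto intro: step_insertI)
  moreover have "insert y K = insert x L" using x y by auto
  ultimately show ?thesis by metis
qed

lemma step_meet:
  assumes "p \<noteq> q" and I: "step p I K" and L: "step q L K"
  shows "\<exists>M. step q M I \<and> step p M L"
proof -
  obtain x where x: "x \<notin> I" "\<epsilon> x = p" "K = insert x I" using I by (auto simp: step_def)
  obtain y where y: "y \<notin> L" "\<epsilon> y = q" "K = insert y L" using L by (auto simp: step_def)
  have proper: "proper_ideal \<epsilon> I" "proper_ideal \<epsilon> L" using I L by (auto simp: step_def)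
  have "x \<noteq> y" using assms(1) x y by auto
  then have eq: "I - {y} = I \<inter> L" "L - {x} = I \<inter> L" and "y \<in> I" "x \<in> L" using x y by auto
  have "heap_ideal (I \<inter> L)"
    using proper by (auto simp: proper_ideal_iff intro: ideal_Int)
  then have "removable {y} I" "removable {x} L"
    using eq \<open>y \<in> I\<close> \<open>x \<in> L\<close> by (auto simp: removable_def)
  then have "step q (I - {y}) I" "step p (L - {x}) L"
    using proper x y by (auto intro: step_removeI)
  then show ?thesis using eq by auto
qed

lemma minuscule: "minuscule_system A {I. proper_ideal \<epsilon> I} step weight"
proof
  fix p and I J K :: "'e set"
  show "generalized_cartan_matrix A" by (rule gcm)
  show "I \<in> {I. proper_ideal \<epsilon> I} \<and> J \<in> {I. proper_ideal \<epsilon> I}" if "step p I J"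
    using that by (auto simp: step_def)
  show "J = K" if J: "step p I J" and K: "step p I K"
  proof -
    have I: "proper_ideal \<epsilon> I" using J by (simp add: step_def)
    obtain \<alpha> \<beta> where cut: "fibre_cut p I \<alpha> \<beta>" using ex_fibre_cut[OF I] by blast
    show ?thesis using J K addable_iff[OF I cut] unfolding step_iff_addable by metis
  qed
  show "I = J" if I: "step p I K" and J: "step p J K"
  proof -
    have K: "proper_ideal \<epsilon> K" using J by (simp add: step_def)
    obtain \<alpha> \<beta> where cut: "fibre_cut p K \<alpha> \<beta>" using ex_fibre_cut[OF K] by blast
    show ?thesis using I J removable_iff[OF K cut] unfolding step_iff_removable by metis
  qed
  show "weight p I \<in> {-1, 0, 1}" if "I \<in> {I. proper_ideal \<epsilon> I}"
    using that ex_fibre_cut[of I p] weight_bounds[of I p] by blast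
qed (use step_weight_iff weight_step step_join step_meet in auto)

section \<open>The heap operators\<close>

lemma heap_space_eq: "heap_space \<epsilon> = formal_span {I. proper_ideal \<epsilon> I}"
  by (simp add: heap_space_def formal_span_def)

text \<open>
  An operator given by an infinite sum over a chain is linear on the heap space as soon as at most
  one summand acts on each \<open>v\<^sub>I\<close>, since each vector then meets only finitely many of them.
\<close>

lemma heap_operator:
  fixes g :: "'e \<Rightarrow> 'e set \<Rightarrow> ('e set \<Rightarrow>\<^sub>0 'k::field)"
  assumes T: "\<And>v. T v = Sum_any (\<lambda>\<alpha>. lin_ext (g \<alpha>) v when \<epsilon> \<alpha> = p)"
    and one: "\<And>I. proper_ideal \<epsilon> I \<Longrightarrow> \<exists>\<alpha>. \<epsilon> \<alpha> = p \<and> (\<forall>\<gamma>. \<epsilon> \<gamma> = p \<longrightarrow> \<gamma> \<noteq> \<alpha> \<longrightarrow> g \<gamma> I = 0)"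
    and g: "\<And>\<alpha> I. proper_ideal \<epsilon> I \<Longrightarrow> \<epsilon> \<alpha> = p \<Longrightarrow> g \<alpha> I \<in> heap_space \<epsilon>"
  shows "fs.endo_on {I. proper_ideal \<epsilon> I} T"
    and "\<And>\<alpha> I. proper_ideal \<epsilon> I \<Longrightarrow> \<epsilon> \<alpha> = p \<Longrightarrow> (\<And>\<gamma>. \<epsilon> \<gamma> = p \<Longrightarrow> \<gamma> \<noteq> \<alpha> \<Longrightarrow> g \<gamma> I = 0) \<Longrightarrow>
           T (basis_vec I) = g \<alpha> I"
proof -
  let ?c = "\<lambda>I. Sum_any (\<lambda>\<alpha>. g \<alpha> I when \<epsilon> \<alpha> = p)"
  have sum: "?c I = g \<alpha> I" if "\<epsilon> \<alpha> = p" "\<And>\<gamma>. \<epsilon> \<gamma> = p \<Longrightarrow> \<gamma> \<noteq> \<alpha> \<Longrightarrow> g \<gamma> I = 0" for I \<alpha>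
    using that by (subst Sum_any_eq_single[of \<alpha>]) (auto simp: when_def)
  have fin: "finite {\<alpha>. \<epsilon> \<alpha> = p \<and> g \<alpha> I \<noteq> 0}" if I: "proper_ideal \<epsilon> I" for I
  proof -
    obtain \<alpha> where "\<forall>\<gamma>. \<epsilon> \<gamma> = p \<longrightarrow> \<gamma> \<noteq> \<alpha> \<longrightarrow> g \<gamma> I = 0" using one[OF I] by blast
    then have "{\<alpha>. \<epsilon> \<alpha> = p \<and> g \<alpha> I \<noteq> 0} \<subseteq> {\<alpha>}" by auto
    then show ?thesis by (rule finite_subset) simp
  qed
  have eq: "T v = lin_ext ?c v" if "v \<in> formal_span {I. proper_ideal \<epsilon> I}" for v
    unfolding T using that fin by (intro Sum_any_lin_ext) (auto simp: formal_span_def)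
  have "?c I \<in> formal_span {I. proper_ideal \<epsilon> I}" if I: "I \<in> {I. proper_ideal \<epsilon> I}" for I
  proof -
    obtain \<alpha> where \<alpha>: "\<epsilon> \<alpha> = p" "\<forall>\<gamma>. \<epsilon> \<gamma> = p \<longrightarrow> \<gamma> \<noteq> \<alpha> \<longrightarrow> g \<gamma> I = 0" using one I by blast
    then have "?c I = g \<alpha> I" by (intro sum) auto
    with g[of I \<alpha>] I \<alpha> show ?thesis by (simp add: heap_space_eq)
  qed
  with eq show "fs.endo_on {I. proper_ideal \<epsilon> I} T" by (rule endo_on_lin_extI)
  show "T (basis_vec I) = g \<alpha> I"
    if "proper_ideal \<epsilon> I" "\<epsilon> \<alpha> = p" "\<And>\<gamma>. \<epsilon> \<gamma> = p \<Longrightarrow> \<gamma> \<noteq> \<alpha> \<Longrightarrow> g \<gamma> I = 0" for \<alpha> I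
    using eq[of "basis_vec I"] that(1) sum[OF that(2,3)]
    by (simp add: basis_vec_in_formal_span lin_ext_basis_vec)
qed

lemma fibre_nonempty: "\<exists>\<alpha>. \<epsilon> \<alpha> = p"
  using fibre_unbounded(1) by blast

lemma addable_unique:
  assumes "proper_ideal \<epsilon> I" "addable {x} I" "addable {y} I" "\<epsilon> x = \<epsilon> y"
  shows "x = y"
proof -
  obtain \<alpha> \<beta> where "fibre_cut (\<epsilon> x) I \<alpha> \<beta>" using ex_fibre_cut[OF assms(1)] by blast
  from addable_iff[OF assms(1) this] assms show ?thesis by metis
qed

lemma removable_unique:
  assumes "proper_ideal \<epsilon> I" "removable {x} I" "removable {y} I" "\<epsilon> x = \<epsilon> y"
  shows "x = y"
proof -
  obtain \<alpha> \<beta> where "fibre_cut (\<epsilon> x) I \<alpha> \<beta>" using ex_fibre_cut[OF assms(1)] by blast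
  from removable_iff[OF assms(1) this] assms show ?thesis by metis
qed

text \<open>
  Common to \<open>X\<^sub>p\<close> and \<open>Y\<^sub>p\<close>: the move \<open>m \<alpha>\<close> is allowed at \<open>I\<close> when \<open>P \<alpha> I\<close> holds, which
  happens for at most one \<open>\<alpha>\<close> of each label.
\<close>

lemma heap_operator_shifts:
  fixes T :: "('e set \<Rightarrow>\<^sub>0 'k::field) \<Rightarrow> ('e set \<Rightarrow>\<^sub>0 'k)"
  assumes T: "\<And>v. T v =
      Sum_any (\<lambda>\<alpha>. lin_ext (\<lambda>I. if P \<alpha> I then basis_vec (m \<alpha> I) else 0) v when \<epsilon> \<alpha> = p)"
    and r: "\<And>I J. r I J \<longleftrightarrow> proper_ideal \<epsilon> I \<and> (\<exists>\<alpha>. P \<alpha> I \<and> \<epsilon> \<alpha> = p \<and> J = m \<alpha> I)"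
    and proper: "\<And>I J. r I J \<Longrightarrow> proper_ideal \<epsilon> J"
    and unique: "\<And>I \<alpha> \<gamma>. proper_ideal \<epsilon> I \<Longrightarrow> P \<alpha> I \<Longrightarrow> P \<gamma> I \<Longrightarrow> \<epsilon> \<alpha> = \<epsilon> \<gamma> \<Longrightarrow> \<alpha> = \<gamma>"
  shows "shifts_basis {I. proper_ideal \<epsilon> I} r T"
proof -
  define g :: "'e \<Rightarrow> 'e set \<Rightarrow> ('e set \<Rightarrow>\<^sub>0 'k)" where
    "g = (\<lambda>\<alpha> I. if P \<alpha> I then basis_vec (m \<alpha> I) else 0)"
  have T: "T v = Sum_any (\<lambda>\<alpha>. lin_ext (g \<alpha>) v when \<epsilon> \<alpha> = p)" for v
    by (simp add: T g_def)
  have zero: "g \<gamma> I = 0"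
    if "proper_ideal \<epsilon> I" "P \<alpha> I" "\<epsilon> \<alpha> = p" "\<epsilon> \<gamma> = p" "\<gamma> \<noteq> \<alpha>" for I \<alpha> \<gamma>
    using that unique[of I \<gamma> \<alpha>] by (auto simp: g_def)
  have one: "\<exists>\<alpha>. \<epsilon> \<alpha> = p \<and> (\<forall>\<gamma>. \<epsilon> \<gamma> = p \<longrightarrow> \<gamma> \<noteq> \<alpha> \<longrightarrow> g \<gamma> I = 0)"
    if I: "proper_ideal \<epsilon> I" for I
  proof (cases "\<exists>\<alpha>. \<epsilon> \<alpha> = p \<and> P \<alpha> I")
    case True
    then show ?thesis using zero[OF I] by blast
  next
    case False
    then show ?thesis using fibre_nonempty[of p] by (auto simp: g_def)
  qed
  have mem: "g \<alpha> I \<in> heap_space \<epsilon>" if "proper_ideal \<epsilon> I" "\<epsilon> \<alpha> = p" for \<alpha> I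
    using that proper[of I "m \<alpha> I"] r by (auto simp: g_def heap_space_def)
  show ?thesis
    unfolding shifts_basis_def
  proof (intro conjI allI ballI impI)
    show "fs.endo_on {I. proper_ideal \<epsilon> I} T"
      by (rule heap_operator(1)[OF T one mem])
  next
    fix I J assume "r I J"
    then obtain \<alpha> where \<alpha>: "proper_ideal \<epsilon> I" "P \<alpha> I" "\<epsilon> \<alpha> = p" "J = m \<alpha> I"
      by (auto simp: r)
    have "T (basis_vec I) = g \<alpha> I"
      using \<alpha> by (intro heap_operator(2)[OF T one mem] zero)
    then show "T (basis_vec I) = basis_vec J"
      using \<alpha> by (simp add: g_def)
  next
    fix I assume "I \<in> {I. proper_ideal \<epsilon> I}" and "\<nexists>J. r I J"
    then have I: "proper_ideal \<epsilon> I" and 0: "\<epsilon> \<gamma> = p \<Longrightarrow> g \<gamma> I = 0" for \<gamma>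
      by (auto simp: g_def r)
    obtain \<alpha> where \<alpha>: "\<epsilon> \<alpha> = p" using fibre_nonempty by blast
    have "T (basis_vec I) = g \<alpha> I"
      using I \<alpha> 0 by (intro heap_operator(2)[OF T one mem])
    then show "T (basis_vec I) = 0"
      using 0 \<alpha> by simp
  qed
qed

lemma X_op_shifts: "shifts_basis {I. proper_ideal \<epsilon> I} (step p) (X_op \<epsilon> p)"
proof (rule heap_operator_shifts)
  show "step p I J \<longleftrightarrow> proper_ideal \<epsilon> I \<and> (\<exists>\<alpha>. addable {\<alpha>} I \<and> \<epsilon> \<alpha> = p \<and> J = I \<union> {\<alpha>})" for I J
    by (simp add: step_iff_addable)
  show "step p I J \<Longrightarrow> proper_ideal \<epsilon> J" for I J
    by (simp add: step_def)
qed (auto simp: X_op_def X_set_def intro: addable_unique)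

lemma Y_op_shifts: "shifts_basis {I. proper_ideal \<epsilon> I} (step p)\<inverse>\<inverse> (Y_op \<epsilon> p)"
proof (rule heap_operator_shifts)
  show "(step p)\<inverse>\<inverse> I J \<longleftrightarrow>
      proper_ideal \<epsilon> I \<and> (\<exists>\<alpha>. removable {\<alpha>} I \<and> \<epsilon> \<alpha> = p \<and> J = I - {\<alpha>})" for I J
    by (simp add: step_iff_removable)
  show "(step p)\<inverse>\<inverse> I J \<Longrightarrow> proper_ideal \<epsilon> J" for I J
    by (simp add: step_def)
qed (auto simp: Y_op_def Y_set_def intro: removable_unique)

text \<open>
  The one active summand belongs to the upper end of the cut when the weight is \<open>-1\<close>, and to its
  lower end when the weight is \<open>1\<close>.
\<close>

lemma H_op_weight:
  shows H_op_endo: "fs.endo_on {I. proper_ideal \<epsilon> I} (H_op \<epsilon> p :: ('e set \<Rightarrow>\<^sub>0 'k::field) \<Rightarrow> _)"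
    and H_op_basis_vec: "proper_ideal \<epsilon> I \<Longrightarrow>
      H_op \<epsilon> p (basis_vec I) = pm_scale (of_int (weight p I)) (basis_vec I :: 'e set \<Rightarrow>\<^sub>0 'k)"
proof -
  define g :: "'e \<Rightarrow> 'e set \<Rightarrow> ('e set \<Rightarrow>\<^sub>0 'k)" where
    "g = (\<lambda>\<alpha> I. if removable {\<alpha>} I \<and> \<not> addable {\<alpha>} I then basis_vec I
                 else if addable {\<alpha>} I \<and> \<not> removable {\<alpha>} I then - basis_vec I else 0)"
  have T: "H_op \<epsilon> p v = Sum_any (\<lambda>\<alpha>. lin_ext (g \<alpha>) v when \<epsilon> \<alpha> = p)" for v
    by (simp add: H_op_def H_set_def g_def)
  have one: "\<exists>\<alpha>. \<epsilon> \<alpha> = p \<and> (\<forall>\<gamma>. \<epsilon> \<gamma> = p \<longrightarrow> \<gamma> \<noteq> \<alpha> \<longrightarrow> g \<gamma> I = 0) \<and>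
      g \<alpha> I = pm_scale (of_int (weight p I)) (basis_vec I)"
    if I: "proper_ideal \<epsilon> I" for I
  proof -
    obtain \<alpha> \<beta> where cut: "fibre_cut p I \<alpha> \<beta>" using ex_fibre_cut[OF I] by blast
    then have "\<epsilon> \<alpha> = p" "\<epsilon> \<beta> = p" "\<alpha> \<noteq> \<beta>" by (auto simp: fibre_cut_def)
    note [simp] = addable_iff[OF I cut] removable_iff[OF I cut]
    consider "weight p I = -1" | "weight p I = 0" | "weight p I = 1"
      using weight_bounds[OF I cut] by auto
    then show ?thesis
    proof cases
      case 1
      then show ?thesis
        using \<open>\<epsilon> \<beta> = p\<close> \<open>\<alpha> \<noteq> \<beta>\<close> by (intro exI[of _ \<beta>]) (simp add: g_def)
    next
      case 2
      then show ?thesis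
        using \<open>\<epsilon> \<beta> = p\<close> by (intro exI[of _ \<beta>]) (simp add: g_def)
    next
      case 3
      then show ?thesis
        using \<open>\<epsilon> \<alpha> = p\<close> \<open>\<alpha> \<noteq> \<beta>\<close> by (intro exI[of _ \<alpha>]) (simp add: g_def)
    qed
  qed
  have one': "\<exists>\<alpha>. \<epsilon> \<alpha> = p \<and> (\<forall>\<gamma>. \<epsilon> \<gamma> = p \<longrightarrow> \<gamma> \<noteq> \<alpha> \<longrightarrow> g \<gamma> I = 0)"
    if "proper_ideal \<epsilon> I" for I
    using one[OF that] by blast
  have mem: "g \<alpha> I \<in> heap_space \<epsilon>" if "proper_ideal \<epsilon> I" for \<alpha> I
    using that by (auto simp: g_def heap_space_def)
  show "fs.endo_on {I. proper_ideal \<epsilon> I} (H_op \<epsilon> p :: ('e set \<Rightarrow>\<^sub>0 'k) \<Rightarrow> _)"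
    by (rule heap_operator(1)[OF T one' mem])
  show "H_op \<epsilon> p (basis_vec I) = pm_scale (of_int (weight p I)) (basis_vec I :: 'e set \<Rightarrow>\<^sub>0 'k)"
    if I: "proper_ideal \<epsilon> I"
  proof -
    obtain \<alpha> where \<alpha>: "\<epsilon> \<alpha> = p" "\<forall>\<gamma>. \<epsilon> \<gamma> = p \<longrightarrow> \<gamma> \<noteq> \<alpha> \<longrightarrow> g \<gamma> I = 0"
      "g \<alpha> I = pm_scale (of_int (weight p I)) (basis_vec I)"
      using one[OF I] by blast
    have "H_op \<epsilon> p (basis_vec I) = g \<alpha> I"
      using I \<alpha>(1,2) by (intro heap_operator(2)[OF T one' mem]) auto
    then show ?thesis using \<alpha>(3) by simp
  qed
qed

end

section \<open>The module structure\<close>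

theorem theorem3p1:
  fixes A :: "'p \<Rightarrow> 'p \<Rightarrow> int"
    and \<epsilon> :: "'e::order \<Rightarrow> 'p"
  assumes "generalized_cartan_matrix A"
    and "full_heap A \<epsilon>"
    and "CHAR('k::field) \<noteq> 2"
  shows "\<exists>act. lie_module (km_algebra A :: ('k, ('k, 'p chevalley) lie_term set) lie_alg)
                 pm_scale (heap_space \<epsilon>) act \<and>
           (\<forall>i. \<forall>v \<in> heap_space \<epsilon>.
              act (km_gen A (E i)) v = X_op \<epsilon> i v \<and>
              act (km_gen A (F i)) v = Y_op \<epsilon> i v \<and>
              act (km_gen A (H i)) v = H_op \<epsilon> i v)"
proof -
  interpret full_heap_over A \<epsilon> using assms(1,2) by unfold_locales
  show ?thesis
    unfolding heap_space_eq
    by (rule minuscule_system.lie_module_of_shifts[OF minuscule])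
       (auto intro: X_op_shifts Y_op_shifts H_op_endo H_op_basis_vec)
qed

end
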